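(* There exists a joint law for a family of random variables $((U_i, Y_{i\to j}) : i\in\mathcal{B},\ j\in\partial\{i\})$, where the $U_i$, $i \in \mathcal{B}$, are independent and uniformly distributed on $[0,1]$ and each $Y_{i\to j}$ takes values in $I=[1/2,1]\cup\{\infty\}$, which is invariant under automorphisms of the tree $\mathcal{B}$ and such that for each $i\in\mathcal{B}$ and each $j\in\partial\{i\}$: (i) $Y_{j\to i}$ has distribution function $F$; (ii) $Y_{j\to i}=\Phi\big(\min(Y_{i\to k},Y_{i\to l}),\max(Y_{i\to k},Y_{i\to l}),U_i\big)$ almost surely, where $\{k,l\}=\partial\{i\}\setminus\{j\}$; and such that (iii) for each finite connected set $S\subset\mathcal{B}$, the variables $(Y_{i\to j}: i\in S,\ j\notin S,\ j\in\partial\{i\})$ are independent of each other and independent of the collection $(U_i:i\in S)$.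
   Context: $\mathcal{B}$ is the infinite 3-regular tree (Bethe lattice), identified with its set of sites (vertices); for a site $i$, $\partial\{i\}$ denotes the set of its three neighbours. The notation $Y_{i\to j}$ is used only for neighbouring sites $i,j$. Let $I=[1/2,1]\cup\{\infty\}$. The function $\Phi: I\times I\times[0,1]\to I$ is defined by $\Phi(x,y,z)=x$ if $x\ge z$; $\Phi(x,y,z)=y$ if $x<z\le y$; and $\Phi(x,y,z)=\infty$ otherwise. $F$ is the distribution function of an $I$-valued random variable given by $F(t)=0$ for $t\le 1/2$, $F(t)=\ln(2t)$ for $1/2<t\le 1$, $F(t)=\ln 2$ for $1<t<\infty$, $F(\infty)=1$ (so there is an atom of mass $1-\ln 2$ at $\infty$). *)

theory Defs
  imports "HOL-Probability.Probability"
begin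

text \<open>Graphs are given by their adjacency relation; the type \<open>'v\<close> is the set of sites.\<close>

definition nbrs :: "('v \<Rightarrow> 'v \<Rightarrow> bool) \<Rightarrow> 'v \<Rightarrow> 'v set" where
  "nbrs adj i = {j. adj i j}"

definition arcs :: "('v \<Rightarrow> 'v \<Rightarrow> bool) \<Rightarrow> ('v \<times> 'v) set" where
  "arcs adj = {(i, j). j \<in> nbrs adj i}"

definition connected_set :: "('v \<Rightarrow> 'v \<Rightarrow> bool) \<Rightarrow> 'v set \<Rightarrow> bool" where
  "connected_set adj S \<longleftrightarrow>
     (\<forall>x\<in>S. \<forall>y\<in>S. (\<lambda>a b. a \<in> S \<and> b \<in> S \<and> adj a b)\<^sup>*\<^sup>* x y)"

definition graph_cycle :: "('v \<Rightarrow> 'v \<Rightarrow> bool) \<Rightarrow> 'v list \<Rightarrow> bool" where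
  "graph_cycle adj xs \<longleftrightarrow>
     3 \<le> length xs \<and> distinct xs \<and> successively adj xs \<and> adj (last xs) (hd xs)"

text \<open>The 3-regular tree is unique up to isomorphism, and automatically infinite.\<close>

definition three_regular_tree :: "('v \<Rightarrow> 'v \<Rightarrow> bool) \<Rightarrow> bool" where
  "three_regular_tree adj \<longleftrightarrow>
     symp adj \<and> irreflp adj \<and>
     connected_set adj UNIV \<and> (\<nexists>xs. graph_cycle adj xs) \<and>
     (\<forall>i. card (nbrs adj i) = 3)"

definition automorphism :: "('v \<Rightarrow> 'v \<Rightarrow> bool) \<Rightarrow> ('v \<Rightarrow> 'v) \<Rightarrow> bool" where
  "automorphism adj \<phi> \<longleftrightarrow> bij \<phi> \<and> (\<forall>i j. adj (\<phi> i) (\<phi> j) \<longleftrightarrow> adj i j)"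

definition I_set :: "ereal set" where
  "I_set = {ereal (1/2)..ereal 1} \<union> {\<infinity>}"

text \<open>Only the values for \<open>x, y \<in> I_set\<close> and \<open>z \<in> {0..1}\<close> are meaningful.\<close>

definition Phi :: "ereal \<Rightarrow> ereal \<Rightarrow> real \<Rightarrow> ereal" where
  "Phi x y z =
     (if x \<ge> ereal z then x
      else if x < ereal z \<and> ereal z \<le> y then y
      else \<infinity>)"

definition F_dist :: "ereal \<Rightarrow> real" where
  "F_dist t =
     (if t \<le> ereal (1/2) then 0
      else if t \<le> ereal 1 then ln (2 * real_of_ereal t)
      else if t < \<infinity> then ln 2
      else 1)"

definition has_distribution_function ::
    "'w measure \<Rightarrow> ('w \<Rightarrow> ereal) \<Rightarrow> (ereal \<Rightarrow> real) \<Rightarrow> bool" where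
  "has_distribution_function P X G \<longleftrightarrow>
     X \<in> borel_measurable P \<and> (\<forall>t. measure P {\<omega> \<in> space P. X \<omega> \<le> t} = G t)"

text \<open>A joint law of the family is a probability measure on the product space
  \<open>[0,1]\<close>-per-site times \<open>I\<close>-per-arc; the variables are the coordinate maps.\<close>

type_synonym 'v config = "('v \<Rightarrow> real) \<times> ('v \<times> 'v \<Rightarrow> ereal)"

definition config_space :: "('v \<Rightarrow> 'v \<Rightarrow> bool) \<Rightarrow> 'v config measure" where
  "config_space adj =
     (\<Pi>\<^sub>M i\<in>UNIV. restrict_space borel {0..1}) \<Otimes>\<^sub>M
     (\<Pi>\<^sub>M e\<in>arcs adj. restrict_space borel I_set)"

definition U_var :: "'v \<Rightarrow> 'v config \<Rightarrow> real" where
  "U_var i \<omega> = fst \<omega> i"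

text \<open>\<open>Y_var i j\<close> is \<open>Y\<^bsub>i\<rightarrow>j\<^esub>\<close>, for neighbouring sites \<open>i\<close> and \<open>j\<close>.\<close>

definition Y_var :: "'v \<Rightarrow> 'v \<Rightarrow> 'v config \<Rightarrow> ereal" where
  "Y_var i j \<omega> = snd \<omega> (i, j)"

definition relabel ::
    "('v \<Rightarrow> 'v \<Rightarrow> bool) \<Rightarrow> ('v \<Rightarrow> 'v) \<Rightarrow> 'v config \<Rightarrow> 'v config" where
  "relabel adj \<phi> \<omega> =
     (\<lambda>i. U_var (\<phi> i) \<omega>, \<lambda>(i, j)\<in>arcs adj. Y_var (\<phi> i) (\<phi> j) \<omega>)"

definition automorphism_invariant ::
    "('v \<Rightarrow> 'v \<Rightarrow> bool) \<Rightarrow> 'v config measure \<Rightarrow> bool" where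
  "automorphism_invariant adj P \<longleftrightarrow>
     (\<forall>\<phi>. automorphism adj \<phi> \<longrightarrow> distr P (config_space adj) (relabel adj \<phi>) = P)"

definition out_arcs :: "('v \<Rightarrow> 'v \<Rightarrow> bool) \<Rightarrow> 'v set \<Rightarrow> ('v \<times> 'v) set" where
  "out_arcs adj S = {(i, j). i \<in> S \<and> j \<notin> S \<and> j \<in> nbrs adj i}"

text \<open>Same as the library's \<open>indep_var\<close>, which requires both variables to have the
  same value type.\<close>

definition indep_pair ::
    "'w measure \<Rightarrow> 'a measure \<Rightarrow> ('w \<Rightarrow> 'a) \<Rightarrow> 'b measure \<Rightarrow> ('w \<Rightarrow> 'b) \<Rightarrow> bool" where
  "indep_pair P A X B Z \<longleftrightarrow>
     X \<in> measurable P A \<and> Z \<in> measurable P B \<and>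
     prob_space.indep_set P
       {X -` C \<inter> space P |C. C \<in> sets A} {Z -` D \<inter> space P |D. D \<in> sets B}"

end

theory Submission imports Defs begin

text \<open>
  The law \<open>F\<close> is a fixed point of the recursion: if the two inputs are independent with law \<open>F\<close>
  and \<open>U\<close> is an independent uniform variable, then the output has law \<open>F\<close> again. Hence, if the
  messages leaving a finite connected set \<open>T \<union> {v}\<close> and the uniform variables in it are independent
  with the right marginals, the same holds for \<open>T\<close>. In a tree, these data determine all messages
  inside \<open>T\<close>, so there is a unique law of the variables attached to \<open>T\<close>, and these laws are
  consistent. The recursion does not determine the messages from the uniform variables alone, so
  the global law comes from Kolmogorov's extension theorem. Its automorphism invariance follows from
  uniqueness of the local laws.
\<close>

section \<open>Independence and identification of laws\<close>

lemma measure_eqI_greaterThan: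
  fixes M N :: "'a::{linorder_topology, second_countable_topology} measure"
  assumes "prob_space M" "prob_space N" and sets: "sets M = sets borel" "sets N = sets borel"
    and eq: "\<And>t. emeasure M {t<..} = emeasure N {t<..}"
  shows "M = N"
proof -
  interpret M: prob_space M by fact
  interpret N: prob_space N by fact
  have UNIV: "space M = UNIV" "space N = UNIV"
    using sets[THEN sets_eq_imp_space_eq] by simp_all
  have "Int_stable (insert UNIV (range greaterThan) :: 'a set set)"
  proof -
    have "{s<..} \<inter> {t<..} = {max s t<..}" for s t :: 'a by auto
    then show ?thesis by (auto simp: Int_stable_def)
  qed
  moreover have "sets borel = sigma_sets UNIV (insert UNIV (range greaterThan) :: 'a set set)"
    unfolding borel_Ioi by (auto intro!: sigma_sets_eqI sigma_sets_top)
  ultimately show ?thesis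
    using eq sets M.emeasure_space_1 N.emeasure_space_1 UNIV
    by (intro measure_eqI_generator_eq[where \<Omega>=UNIV and A="\<lambda>_. UNIV"
      and E="insert UNIV (range greaterThan)"]) auto
qed

lemma (in prob_space) indep_vars_reindex:
  assumes "indep_vars M' X I" "inj_on f K" "f ` K \<subseteq> I"
  shows "indep_vars (\<lambda>i. M' (f i)) (\<lambda>i. X (f i)) K"
proof -
  have "indep_vars (\<lambda>i. PiM {f i} M') (\<lambda>i \<omega>. restrict (\<lambda>j. X j \<omega>) {f i}) K"
    using assms by (intro indep_vars_restrict[OF assms(1)])
      (auto simp: disjoint_family_on_def inj_on_def)
  then have "indep_vars (\<lambda>i. M' (f i)) (\<lambda>i \<omega>. restrict (\<lambda>j. X j \<omega>) {f i} (f i)) K"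
    by (rule indep_vars_compose2[where Y="\<lambda>i g. g (f i)"]) simp
  then show ?thesis by simp
qed

lemma (in prob_space) indep_vars_distr_iff:
  assumes E: "E \<in> measurable M N" and X: "\<And>i. i \<in> I \<Longrightarrow> X i \<in> measurable N (M' i)"
  shows "prob_space.indep_vars (distr M N E) M' X I \<longleftrightarrow> indep_vars M' (\<lambda>i \<omega>. X i (E \<omega>)) I"
proof (cases "I = {}")
  case True
  interpret D: prob_space "distr M N E" by (rule prob_space_distr[OF E])
  show ?thesis
    using True by (simp add: indep_vars_def D.indep_vars_def indep_sets_def D.indep_sets_def)
next
  case False
  interpret D: prob_space "distr M N E" by (rule prob_space_distr[OF E])
  have "(\<lambda>x. \<lambda>i\<in>I. X i x) \<in> measurable N (PiM I M')" using X by (rule measurable_restrict)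
  then have "distr (distr M N E) (PiM I M') (\<lambda>x. \<lambda>i\<in>I. X i x)
      = distr M (PiM I M') (\<lambda>\<omega>. \<lambda>i\<in>I. X i (E \<omega>))"
    using E by (subst distr_distr) (simp_all add: comp_def)
  moreover have "(\<Pi>\<^sub>M i\<in>I. distr (distr M N E) (M' i) (X i))
      = (\<Pi>\<^sub>M i\<in>I. distr M (M' i) (\<lambda>\<omega>. X i (E \<omega>)))"
    using X E by (intro PiM_cong) (simp_all add: distr_distr comp_def)
  ultimately show ?thesis
    using False X measurable_compose[OF E X]
    by (simp add: indep_vars_iff_distr_eq_PiM' D.indep_vars_iff_distr_eq_PiM')
qed

lemma (in prob_space) indep_varsI_finite_subsets:
  assumes "\<And>i. i \<in> I \<Longrightarrow> random_variable (M' i) (X i)"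
    and "\<And>J. finite J \<Longrightarrow> J \<subseteq> I \<Longrightarrow> indep_vars M' X J"
  shows "indep_vars M' X I"
  using assms unfolding indep_vars_def2 indep_sets_finite_index_sets[of _ I] by blast

lemma (in prob_space) indep_pair_iff:
  "indep_pair M A X B Z \<longleftrightarrow> random_variable A X \<and> random_variable B Z \<and>
    (\<forall>C\<in>sets A. \<forall>D\<in>sets B. prob ((X -` C \<inter> space M) \<inter> (Z -` D \<inter> space M))
       = prob (X -` C \<inter> space M) * prob (Z -` D \<inter> space M))"
  unfolding indep_pair_def indep_sets2_eq Setcompr_eq_image by (auto simp: measurable_sets)

lemma (in prob_space) indep_pair_compose:
  assumes indep: "indep_var A X B Z" and f: "f \<in> measurable A A'" and g: "g \<in> measurable B B'"
  shows "indep_pair M A' (\<lambda>\<omega>. f (X \<omega>)) B' (\<lambda>\<omega>. g (Z \<omega>))"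
  unfolding indep_pair_iff
proof (intro conjI ballI)
  have X: "random_variable A X" and Z: "random_variable B Z"
    using indep by (rule indep_var_rv1, rule indep_var_rv2)
  then show "random_variable A' (\<lambda>\<omega>. f (X \<omega>))" "random_variable B' (\<lambda>\<omega>. g (Z \<omega>))"
    using f g by (auto intro: measurable_compose)
  fix C D assume C: "C \<in> sets A'" and D: "D \<in> sets B'"
  let ?C = "f -` C \<inter> space A" and ?D = "g -` D \<inter> space B"
  have "prob ((\<lambda>\<omega>. (X \<omega>, Z \<omega>)) -` (?C \<times> ?D) \<inter> space M)
      = prob (X -` ?C \<inter> space M) * prob (Z -` ?D \<inter> space M)"
    using C D f g by (intro indep_varD[OF indep] measurable_sets)
  moreover have "X -` ?C \<inter> space M = (\<lambda>\<omega>. f (X \<omega>)) -` C \<inter> space M"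
    "Z -` ?D \<inter> space M = (\<lambda>\<omega>. g (Z \<omega>)) -` D \<inter> space M"
    using measurable_space[OF X] measurable_space[OF Z] by auto
  moreover have "(\<lambda>\<omega>. (X \<omega>, Z \<omega>)) -` (?C \<times> ?D) \<inter> space M
      = (X -` ?C \<inter> space M) \<inter> (Z -` ?D \<inter> space M)"
    by auto
  ultimately show "prob (((\<lambda>\<omega>. f (X \<omega>)) -` C \<inter> space M) \<inter> ((\<lambda>\<omega>. g (Z \<omega>)) -` D \<inter> space M))
      = prob ((\<lambda>\<omega>. f (X \<omega>)) -` C \<inter> space M) * prob ((\<lambda>\<omega>. g (Z \<omega>)) -` D \<inter> space M)"
    by simp
qed

lemma (in prob_space) indep_pair_distr:
  assumes E: "E \<in> measurable M N" and X: "X \<in> measurable N A" and Z: "Z \<in> measurable N B"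
    and indep: "indep_pair M A (\<lambda>\<omega>. X (E \<omega>)) B (\<lambda>\<omega>. Z (E \<omega>))"
  shows "indep_pair (distr M N E) A X B Z"
proof -
  interpret D: prob_space "distr M N E" by (rule prob_space_distr[OF E])
  have vimage_E: "E -` (V -` C \<inter> space N) \<inter> space M = (\<lambda>\<omega>. V (E \<omega>)) -` C \<inter> space M"
    for V :: "'b \<Rightarrow> 'z" and C
    using measurable_space[OF E] by auto
  have "D.prob ((X -` C \<inter> space N) \<inter> (Z -` D \<inter> space N))
      = D.prob (X -` C \<inter> space N) * D.prob (Z -` D \<inter> space N)"
    if C: "C \<in> sets A" and D: "D \<in> sets B" for C D
  proof -
    note sets_N = measurable_sets[OF X C] measurable_sets[OF Z D]
    have vimage_Int_E: "E -` ((X -` C \<inter> space N) \<inter> (Z -` D \<inter> space N)) \<inter> space M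
        = ((\<lambda>\<omega>. X (E \<omega>)) -` C \<inter> space M) \<inter> ((\<lambda>\<omega>. Z (E \<omega>)) -` D \<inter> space M)"
      using measurable_space[OF E] by auto
    show ?thesis
      unfolding measure_distr[OF E sets_N(1)] measure_distr[OF E sets_N(2)]
        measure_distr[OF E sets.Int[OF sets_N]] vimage_E vimage_Int_E
      using indep C D unfolding indep_pair_iff by blast
  qed
  then show ?thesis unfolding D.indep_pair_iff using X Z by simp
qed

section \<open>Marginals of measures on product spaces\<close>

abbreviation (input) borel_PiM :: "'i set \<Rightarrow> ('i \<Rightarrow> 'a::topological_space) measure" where
  "borel_PiM J \<equiv> PiM J (\<lambda>_. borel)"

definition marginal :: "'i set \<Rightarrow> ('i \<Rightarrow> 'a::topological_space) measure \<Rightarrow> ('i \<Rightarrow> 'a) measure" where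
  "marginal J Q = distr Q (borel_PiM J) (\<lambda>\<omega>. restrict \<omega> J)"

lemma sets_marginal [simp, measurable_cong]: "sets (marginal J Q) = sets (borel_PiM J)"
  by (simp add: marginal_def)

lemma measurable_restrict_coords:
  assumes "sets Q = sets (borel_PiM K)" "J \<subseteq> K"
  shows "(\<lambda>\<omega>. restrict \<omega> J) \<in> measurable Q (borel_PiM J)"
  using assms by (subst measurable_cong_sets[OF _ refl]) (auto intro: measurable_restrict_subset)

lemma measurable_coord:
  assumes "sets Q = sets (borel_PiM K)" "i \<in> K"
  shows "(\<lambda>\<omega>. \<omega> i) \<in> borel_measurable Q"
  using assms by (subst measurable_cong_sets[OF _ refl])
    (auto intro: measurable_component_singleton)

lemma space_borel_PiM: "space (borel_PiM J) = extensional J"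
  by (simp add: space_PiM PiE_def)

lemma prob_space_marginal:
  assumes "prob_space Q" "sets Q = sets (borel_PiM K)" "J \<subseteq> K"
  shows "prob_space (marginal J Q)"
  unfolding marginal_def
  by (rule prob_space.prob_space_distr[OF assms(1) measurable_restrict_coords[OF assms(2,3)]])

lemma marginal_marginal:
  assumes "sets Q = sets (borel_PiM K)" "J \<subseteq> H" "H \<subseteq> K"
  shows "marginal J (marginal H Q) = marginal J Q"
  unfolding marginal_def using assms(2)
  by (subst distr_distr[OF measurable_restrict_subset measurable_restrict_coords[OF assms(1,3)]])
    (simp_all add: comp_def Int_absorb1)

lemma marginal_self:
  assumes "sets Q = sets (borel_PiM K)"
  shows "marginal K Q = Q"
proof -
  have "marginal K Q = distr Q Q (\<lambda>\<omega>. \<omega>)"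
    unfolding marginal_def
    using assms sets_eq_imp_space_eq[OF assms]
    by (intro distr_cong) (auto simp: space_borel_PiM extensional_restrict)
  then show ?thesis by simp
qed

lemma distr_coord_eq_distr_marginal:
  assumes "sets Q = sets (borel_PiM K)" "i \<in> J" "J \<subseteq> K"
  shows "distr Q borel (\<lambda>\<omega>. \<omega> i) = distr (marginal J Q) borel (\<lambda>\<omega>. \<omega> i)"
  unfolding marginal_def using assms(2)
  by (subst distr_distr[OF measurable_component_singleton
      measurable_restrict_coords[OF assms(1,3)]])
    (simp_all add: comp_def)

lemma measurable_compose_borel_PiM:
  assumes "f \<in> borel_measurable borel"
  shows "compose K f \<in> measurable (borel_PiM K) (borel_PiM K)"
  unfolding compose_def[abs_def] using assms by measurable

lemma marginal_distr_compose:
  assumes Q: "sets Q = sets (borel_PiM K)" and J: "J \<subseteq> K" and f: "f \<in> borel_measurable borel"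
  shows "marginal J (distr Q (borel_PiM K) (compose K f))
    = distr (marginal J Q) (borel_PiM J) (compose J f)"
proof -
  note compose_measurable = measurable_compose_borel_PiM[OF f]
  have "compose K f \<in> measurable Q (borel_PiM K)"
    using compose_measurable Q by (simp cong: measurable_cong_sets)
  then have "marginal J (distr Q (borel_PiM K) (compose K f))
      = distr Q (borel_PiM J) (\<lambda>\<omega>. restrict (compose K f \<omega>) J)"
    unfolding marginal_def
    by (subst distr_distr[OF measurable_restrict_subset[OF J]]) (simp_all add: comp_def)
  also have "\<dots> = distr Q (borel_PiM J) (\<lambda>\<omega>. compose J f (restrict \<omega> J))"
    using J by (intro distr_cong) (auto simp: compose_def fun_eq_iff)
  also have "\<dots> = distr (marginal J Q) (borel_PiM J) (compose J f)"
    unfolding marginal_def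
    by (subst distr_distr[OF compose_measurable measurable_restrict_coords[OF Q J]])
      (simp add: comp_def)
  finally show ?thesis .
qed

lemma measure_eqI_marginals:
  assumes "prob_space Q" "sets Q = sets (borel_PiM I)" "sets Q' = sets (borel_PiM I)"
    and marginals: "\<And>J. finite J \<Longrightarrow> J \<subseteq> I \<Longrightarrow> marginal J Q = marginal J Q'"
  shows "Q = Q'"
proof (rule measure_eqI_PiM_infinite[where I=I and M="\<lambda>_. borel"])
  interpret prob_space Q by fact
  show "finite_measure Q" by unfold_locales
  fix A :: "'a \<Rightarrow> 'b set" and J
  assume J: "finite J" "J \<subseteq> I" and A: "\<And>i. i \<in> J \<Longrightarrow> A i \<in> sets borel"
  have "Pi\<^sub>E J A \<in> sets (borel_PiM J)" using J A by (intro sets_PiM_I_finite) auto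
  then show "emeasure Q (prod_emb I (\<lambda>_. borel) J (Pi\<^sub>E J A))
      = emeasure Q' (prod_emb I (\<lambda>_. borel) J (Pi\<^sub>E J A))"
    using marginals[OF J] assms(2,3) J(2) unfolding marginal_def
    by (metis emeasure_distr_restrict)
qed (use assms in auto)

lemma indep_vars_PiM_coords:
  assumes "\<And>i. prob_space (M i)" "I \<noteq> {}"
  shows "prob_space.indep_vars (PiM I M) M (\<lambda>i g. g i) I"
proof -
  interpret prob_space "PiM I M" by (intro prob_space_PiM assms)
  have "distr (PiM I M) (PiM I M) (\<lambda>g. \<lambda>i\<in>I. g i) = (\<Pi>\<^sub>M i\<in>I. distr (PiM I M) (M i) (\<lambda>g. g i))"
    using distr_PiM_reindex[of I M "\<lambda>i. i" I] assms(1) distr_PiM_component[of I M]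
    by (simp cong: PiM_cong)
  then show ?thesis
    using assms(2) by (subst indep_vars_iff_distr_eq_PiM') auto
qed

lemma distr_PiM_disjoint_blocks:
  assumes M: "\<And>i. prob_space (M i)" and K: "\<And>j. j \<in> J \<Longrightarrow> K j \<subseteq> I" "disjoint_family_on K J"
    and f: "\<And>j. j \<in> J \<Longrightarrow> f j \<in> measurable (PiM (K j) M) (N j)" and nonempty: "I \<noteq> {}" "J \<noteq> {}"
  shows "distr (PiM I M) (PiM J N) (\<lambda>g. \<lambda>j\<in>J. f j (restrict g (K j)))
    = (\<Pi>\<^sub>M j\<in>J. distr (PiM (K j) M) (N j) (f j))"
proof -
  interpret prob_space "PiM I M" by (intro prob_space_PiM M)
  have restrict_measurable: "(\<lambda>g. restrict g (K j)) \<in> measurable (PiM I M) (PiM (K j) M)"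
    if "j \<in> J" for j
    using K(1)[OF that] by (rule measurable_restrict_subset)
  have "indep_vars (\<lambda>j. PiM (K j) M) (\<lambda>j g. restrict g (K j)) J"
    using indep_vars_restrict[OF indep_vars_PiM_coords[OF M nonempty(1)] K] .
  then have "indep_vars N (\<lambda>j g. f j (restrict g (K j))) J"
    by (rule indep_vars_compose2) (rule f)
  then have "distr (PiM I M) (PiM J N) (\<lambda>g. \<lambda>j\<in>J. f j (restrict g (K j)))
      = (\<Pi>\<^sub>M j\<in>J. distr (PiM I M) (N j) (\<lambda>g. f j (restrict g (K j))))"
    using nonempty measurable_compose[OF restrict_measurable f]
    by (subst (asm) indep_vars_iff_distr_eq_PiM') auto
  also have "\<dots> = (\<Pi>\<^sub>M j\<in>J. distr (PiM (K j) M) (N j) (f j))"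
  proof (rule PiM_cong)
    fix j assume j: "j \<in> J"
    have "distr (PiM I M) (PiM (K j) M) (\<lambda>g. restrict g (K j)) = PiM (K j) M"
      using distr_PiM_reindex[of I M "\<lambda>i. i" "K j"] K(1)[OF j] M by auto
    with distr_distr[OF f[OF j] restrict_measurable[OF j]]
    show "distr (PiM I M) (N j) (\<lambda>g. f j (restrict g (K j))) = distr (PiM (K j) M) (N j) (f j)"
      by (simp add: comp_def)
  qed simp
  finally show ?thesis .
qed

section \<open>Kolmogorov extension along a cofinal family\<close>

locale cofinal_projective_family =
  fixes I :: "'i set" and \<S> :: "'s set" and V :: "'s \<Rightarrow> 'i set"
    and L :: "'s \<Rightarrow> ('i \<Rightarrow> 'a::topological_space) measure"
  assumes V_subset: "S \<in> \<S> \<Longrightarrow> V S \<subseteq> I"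
    and cofinal: "finite J \<Longrightarrow> J \<subseteq> I \<Longrightarrow> \<exists>S\<in>\<S>. J \<subseteq> V S"
    and finite_V: "S \<in> \<S> \<Longrightarrow> finite (V S)"
    and prob_space_L: "S \<in> \<S> \<Longrightarrow> prob_space (L S)"
    and sets_L: "S \<in> \<S> \<Longrightarrow> sets (L S) = sets (borel_PiM (V S))"
    and consistent: "S \<in> \<S> \<Longrightarrow> T \<in> \<S> \<Longrightarrow> V S \<subseteq> V T \<Longrightarrow> marginal (V S) (L T) = L S"
begin

definition finite_marginal :: "'i set \<Rightarrow> ('i \<Rightarrow> 'a) measure" where
  "finite_marginal J = marginal J (L (SOME S. S \<in> \<S> \<and> J \<subseteq> V S))"

lemma finite_marginal_eq:
  assumes S: "S \<in> \<S>" "J \<subseteq> V S"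
  shows "finite_marginal J = marginal J (L S)"
proof -
  define T where "T = (SOME S. S \<in> \<S> \<and> J \<subseteq> V S)"
  have T: "T \<in> \<S>" "J \<subseteq> V T"
    using someI[of "\<lambda>S. S \<in> \<S> \<and> J \<subseteq> V S", OF conjI[OF S]]
    by (auto simp: T_def)
  obtain H where H: "H \<in> \<S>" "V S \<union> V T \<subseteq> V H"
    using cofinal[of "V S \<union> V T"] S T finite_V V_subset by auto
  have "marginal J (L R) = marginal J (L H)" if "R \<in> \<S>" "J \<subseteq> V R" "V R \<subseteq> V H" for R
    using consistent[OF that(1) H(1) that(3)] marginal_marginal[OF sets_L[OF H(1)] that(2,3)]
    by metis
  with S T H show ?thesis by (simp add: finite_marginal_def flip: T_def)
qed

lemma unique_extension:
  assumes "prob_space Q" "sets Q = sets (borel_PiM I)" "sets Q' = sets (borel_PiM I)"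
    and "\<And>S. S \<in> \<S> \<Longrightarrow> marginal (V S) Q = L S" "\<And>S. S \<in> \<S> \<Longrightarrow> marginal (V S) Q' = L S"
  shows "Q = Q'"
proof (rule measure_eqI_marginals[OF assms(1-3)])
  fix J assume "finite J" "J \<subseteq> I"
  then obtain S where "S \<in> \<S>" "J \<subseteq> V S" using cofinal by blast
  then show "marginal J Q = marginal J Q'"
    using assms V_subset marginal_marginal by metis
qed

end

lemma (in polish_projective) marginal_lim:
  assumes "finite J" "J \<subseteq> I"
  shows "marginal J lim = P J"
proof (rule measure_eqI)
  show "sets (marginal J lim) = sets (P J)" using assms by (simp add: sets_P)
  fix A assume "A \<in> sets (marginal J lim)"
  then show "emeasure (marginal J lim) A = emeasure (P J) A"
    using assms by (simp add: marginal_def emeasure_distr_restrict emeasure_lim_emb)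
qed

lemma polish_extension_exists:
  fixes L :: "'s \<Rightarrow> ('i \<Rightarrow> 'a::polish_space) measure"
  assumes "cofinal_projective_family I \<S> V L"
  obtains Q where "prob_space Q" "sets Q = sets (borel_PiM I)" "\<And>S. S \<in> \<S> \<Longrightarrow> marginal (V S) Q = L S"
proof -
  interpret cofinal_projective_family I \<S> V L by fact
  interpret polish_projective I finite_marginal
  proof (intro polish_projective.intro projective_family.intro)
    fix J H assume H: "J \<subseteq> H" "finite H" "H \<subseteq> I"
    then obtain S where S: "S \<in> \<S>" "H \<subseteq> V S" using cofinal by blast
    then show "finite_marginal J = distr (finite_marginal H) (borel_PiM J) (\<lambda>f. restrict f J)"
      using H marginal_marginal[OF sets_L[OF S(1)] H(1) S(2)] finite_marginal_eq[OF S(1)]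
      by (simp add: marginal_def)
  next
    fix J assume "finite J" "J \<subseteq> I"
    then obtain S where "S \<in> \<S>" "J \<subseteq> V S" using cofinal by blast
    then show "prob_space (finite_marginal J)"
      using prob_space_marginal[OF prob_space_L sets_L] by (simp add: finite_marginal_eq)
  qed
  have "marginal (V S) lim = L S" if "S \<in> \<S>" for S
    using that by (simp add: marginal_lim finite_V V_subset finite_marginal_eq marginal_self sets_L)
  then show thesis using that P.prob_space_axioms by simp
qed

text \<open>The type \<open>ereal\<close> is not an instance of \<open>polish_space\<close>, but it embeds into one.\<close>

lemma embedded_extension_exists:
  fixes L :: "'s \<Rightarrow> ('i \<Rightarrow> 'a::topological_space) measure" and enc :: "'a \<Rightarrow> 'b::polish_space"
  assumes "cofinal_projective_family I \<S> V L"
    and enc: "enc \<in> borel_measurable borel" and dec: "dec \<in> borel_measurable borel"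
    and dec_enc: "\<And>x. dec (enc x) = x"
  obtains Q where "prob_space Q" "sets Q = sets (borel_PiM I)" "\<And>S. S \<in> \<S> \<Longrightarrow> marginal (V S) Q = L S"
proof -
  interpret cofinal_projective_family I \<S> V L by fact
  note compose_enc = measurable_compose_borel_PiM[OF enc]
    and compose_dec = measurable_compose_borel_PiM[OF dec]
  have compose_L: "compose K enc \<in> measurable (L S) (borel_PiM K)" if "S \<in> \<S>" "V S = K" for S K
    using compose_enc sets_L that by (simp cong: measurable_cong_sets)
  have "cofinal_projective_family I \<S> V (\<lambda>S. distr (L S) (borel_PiM (V S)) (compose (V S) enc))"
  proof (rule cofinal_projective_family.intro)
    fix S T assume "S \<in> \<S>" "T \<in> \<S>" "V S \<subseteq> V T"
    then show "marginal (V S) (distr (L T) (borel_PiM (V T)) (compose (V T) enc))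
        = distr (L S) (borel_PiM (V S)) (compose (V S) enc)"
      by (simp add: marginal_distr_compose[OF sets_L _ enc] consistent)
  qed (simp_all add: V_subset cofinal finite_V
      prob_space.prob_space_distr[OF prob_space_L compose_L])
  then obtain Q where Q: "prob_space Q" "sets Q = sets (borel_PiM I)"
    and marginal_Q: "\<And>S. S \<in> \<S> \<Longrightarrow>
      marginal (V S) Q = distr (L S) (borel_PiM (V S)) (compose (V S) enc)"
    by (rule polish_extension_exists) blast
  have "marginal (V S) (distr Q (borel_PiM I) (compose I dec)) = L S" if S: "S \<in> \<S>" for S
  proof -
    have "marginal (V S) (distr Q (borel_PiM I) (compose I dec))
        = distr (distr (L S) (borel_PiM (V S)) (compose (V S) enc))
            (borel_PiM (V S)) (compose (V S) dec)"
      using marginal_distr_compose[OF Q(2) V_subset[OF S] dec] marginal_Q[OF S] by simp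
    also have "\<dots> = distr (L S) (borel_PiM (V S)) (\<lambda>g. restrict g (V S))"
      by (subst distr_distr[OF compose_dec compose_L[OF S refl]])
        (auto simp: comp_def compose_def dec_enc fun_eq_iff intro!: distr_cong)
    finally show ?thesis using marginal_self[OF sets_L[OF S]] by (simp add: marginal_def)
  qed
  moreover have "prob_space (distr Q (borel_PiM I) (compose I dec))"
    using compose_dec Q by (intro prob_space.prob_space_distr) (simp_all cong: measurable_cong_sets)
  ultimately show thesis using that by simp
qed

section \<open>Locally finite trees\<close>

lemma rtranclp_imp_distinct_path:
  assumes "r\<^sup>*\<^sup>* x y"
  shows "\<exists>xs. xs \<noteq> [] \<and> distinct xs \<and> successively r xs \<and> hd xs = x \<and> last xs = y"
  using assms
proof (induction rule: converse_rtranclp_induct)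
  case base
  show ?case by (intro exI[of _ "[y]"]) simp
next
  case (step x z)
  then obtain xs where xs: "xs \<noteq> []" "distinct xs" "successively r xs" "hd xs = z" "last xs = y"
    by blast
  show ?case
  proof (cases "x \<in> set xs")
    case True
    then obtain ys zs where "xs = ys @ x # zs" by (meson split_list)
    with xs show ?thesis
      by (intro exI[of _ "x # zs"]) (auto simp: successively_append_iff)
  next
    case False
    with xs step(1) show ?thesis
      by (intro exI[of _ "x # xs"]) (auto simp: successively_Cons)
  qed
qed

lemma connected_singleton: "connected_set adj {i}"
  by (simp add: connected_set_def)

lemma adj_automorphism_iff: "automorphism adj \<phi> \<Longrightarrow> adj (\<phi> i) (\<phi> j) \<longleftrightarrow> adj i j"
  by (simp add: automorphism_def)

lemma inj_automorphism: "automorphism adj \<phi> \<Longrightarrow> inj \<phi>"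
  by (simp add: automorphism_def bij_is_inj)

lemma nbrs_automorphism:
  assumes "automorphism adj \<phi>"
  shows "nbrs adj (\<phi> i) = \<phi> ` nbrs adj i"
proof (intro equalityI subsetI)
  fix k assume k: "k \<in> nbrs adj (\<phi> i)"
  obtain k' where "k = \<phi> k'" using assms by (metis automorphism_def bij_pointE)
  with k show "k \<in> \<phi> ` nbrs adj i" by (simp add: nbrs_def adj_automorphism_iff[OF assms])
qed (auto simp: nbrs_def adj_automorphism_iff[OF assms])

lemma connected_image:
  assumes "automorphism adj \<phi>" "connected_set adj S"
  shows "connected_set adj (\<phi> ` S)"
  unfolding connected_set_def
proof (safe)
  fix x y assume "x \<in> S" "y \<in> S"
  then have "(\<lambda>a b. a \<in> S \<and> b \<in> S \<and> adj a b)\<^sup>*\<^sup>* x y"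
    using assms(2) by (auto simp: connected_set_def)
  then show "(\<lambda>a b. a \<in> \<phi> ` S \<and> b \<in> \<phi> ` S \<and> adj a b)\<^sup>*\<^sup>* (\<phi> x) (\<phi> y)"
  proof (induction rule: rtranclp_induct)
    case (step y z)
    then have "\<phi> y \<in> \<phi> ` S \<and> \<phi> z \<in> \<phi> ` S \<and> adj (\<phi> y) (\<phi> z)"
      by (auto simp: adj_automorphism_iff[OF assms(1)])
    with step.IH show ?case by (rule rtranclp.rtrancl_into_rtrancl)
  qed simp
qed

lemma boundary_edge_exists:
  assumes S: "connected_set adj S" and T: "T \<subseteq> S" "T \<noteq> {}" "T \<noteq> S"
  shows "\<exists>u v. u \<in> T \<and> v \<in> S - T \<and> adj u v"
proof -
  from T obtain s x where sx: "s \<in> T" "x \<in> S - T" by blast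
  then have "(\<lambda>a b. a \<in> S \<and> b \<in> S \<and> adj a b)\<^sup>*\<^sup>* s x"
    using S T by (auto simp: connected_set_def)
  then have "x \<in> T \<or> (\<exists>u v. u \<in> T \<and> v \<in> S - T \<and> adj u v)"
    by (induction rule: rtranclp_induct) (use sx in auto)
  with sx show ?thesis by blast
qed

locale locally_finite_tree =
  fixes adj :: "'v \<Rightarrow> 'v \<Rightarrow> bool"
  assumes adj_sym: "adj i j \<Longrightarrow> adj j i"
    and adj_irrefl: "\<not> adj i i"
    and connected: "connected_set adj UNIV"
    and acyclic: "\<not> graph_cycle adj xs"
    and finite_nbrs: "finite (nbrs adj i)"
begin

lemma unique_nbr_in_connected:
  assumes S: "connected_set adj S" and uw: "u \<in> S" "w \<in> S" and v: "v \<notin> S" "adj u v" "adj w v"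
  shows "u = w"
proof (rule ccontr)
  assume "u \<noteq> w"
  let ?r = "\<lambda>a b. a \<in> S \<and> b \<in> S \<and> adj a b"
  have "?r\<^sup>*\<^sup>* u w" using S uw by (auto simp: connected_set_def)
  from rtranclp_imp_distinct_path[OF this] obtain xs where
    xs: "xs \<noteq> []" "distinct xs" "successively ?r xs" "hd xs = u" "last xs = w" by blast
  then obtain ys where ys: "xs = u # ys" "ys \<noteq> []"
    using \<open>u \<noteq> w\<close> by (cases xs) (auto split: if_splits)
  have path_subset: "set zs \<subseteq> S" if "successively ?r zs" "hd zs \<in> S" for zs
    using that by (induction zs rule: induct_list012) auto
  have "successively adj xs" using xs(3) by (rule successively_mono) auto
  then have "graph_cycle adj (v # xs)"
    using ys xs v path_subset[OF xs(3)] uw adj_sym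
    by (auto simp: graph_cycle_def successively_Cons Suc_le_eq)
  then show False using acyclic by blast
qed

lemma connected_insert:
  assumes "connected_set adj S" "u \<in> S" "adj u v"
  shows "connected_set adj (insert v S)"
proof -
  let ?r = "\<lambda>a b. a \<in> insert v S \<and> b \<in> insert v S \<and> adj a b"
  have S: "?r\<^sup>*\<^sup>* x y" if "x \<in> S" "y \<in> S" for x y
  proof -
    have "(\<lambda>a b. a \<in> S \<and> b \<in> S \<and> adj a b)\<^sup>*\<^sup>* x y"
      using assms(1) that by (auto simp: connected_set_def)
    then show ?thesis by (rule rtranclp_mono[THEN predicate2D, rotated]) auto
  qed
  have uv: "?r\<^sup>*\<^sup>* u v" "?r\<^sup>*\<^sup>* v u" using assms adj_sym by auto
  show ?thesis
    unfolding connected_set_def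
    using S uv assms(2) by (auto intro: rtranclp_trans)
qed

definition finite_subtrees :: "'v set set" where
  "finite_subtrees = {S. finite S \<and> connected_set adj S \<and> S \<noteq> {}}"

lemma singleton_finite_subtree: "{i} \<in> finite_subtrees"
  by (simp add: finite_subtrees_def connected_singleton)

lemma insert_finite_subtree:
  "S \<in> finite_subtrees \<Longrightarrow> u \<in> S \<Longrightarrow> adj u v \<Longrightarrow> insert v S \<in> finite_subtrees"
  by (auto simp: finite_subtrees_def intro: connected_insert)

lemma finite_subtree_extend_to:
  assumes S: "S \<in> finite_subtrees"
  shows "\<exists>T\<in>finite_subtrees. S \<subseteq> T \<and> x \<in> T"
proof -
  obtain s where s: "s \<in> S" using S by (auto simp: finite_subtrees_def)
  have "adj\<^sup>*\<^sup>* s x" using connected by (simp add: connected_set_def)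
  then show ?thesis
  proof (induction rule: rtranclp_induct)
    case base
    then show ?case using S s by blast
  next
    case (step y z)
    then obtain T where "T \<in> finite_subtrees" "S \<subseteq> T" "y \<in> T" by blast
    with step(2) show ?case
      by (intro bexI[of _ "insert z T"]) (auto intro: insert_finite_subtree)
  qed
qed

lemma finite_subtree_superset:
  assumes "finite K"
  shows "\<exists>S\<in>finite_subtrees. K \<subseteq> S"
  using assms
proof (induction K rule: finite_induct)
  case empty
  show ?case using singleton_finite_subtree by blast
next
  case (insert x K)
  then show ?case using finite_subtree_extend_to[of _ x] by (metis insert_subset order_trans)
qed

lemma finite_subtree_induct [consumes 3, case_names base step]:
  assumes S: "S \<in> finite_subtrees" and S\<^sub>0: "S\<^sub>0 \<in> finite_subtrees" "S\<^sub>0 \<subseteq> S"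
    and base: "R S\<^sub>0"
    and step: "\<And>T u v. T \<in> finite_subtrees \<Longrightarrow> u \<in> T \<Longrightarrow> v \<notin> T \<Longrightarrow> adj u v \<Longrightarrow> R T \<Longrightarrow> R (insert v T)"
  shows "R S"
proof -
  have "R S" if "T \<in> finite_subtrees" "T \<subseteq> S" "R T" for T
    using that
  proof (induction "card (S - T)" arbitrary: T rule: less_induct)
    case less
    show ?case
    proof (cases "T = S")
      case False
      then obtain u v where uv: "u \<in> T" "v \<in> S - T" "adj u v"
        using boundary_edge_exists[of adj S T] S less.prems by (auto simp: finite_subtrees_def)
      have "S - insert v T \<subset> S - T" using uv by blast
      then have "card (S - insert v T) < card (S - T)"
        using S by (intro psubset_card_mono) (auto simp: finite_subtrees_def)
      then show ?thesis
        using uv less.prems by (intro less.hyps[of "insert v T"] step insert_finite_subtree) auto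
    qed (use less in simp)
  qed
  with S\<^sub>0 base show ?thesis by blast
qed

end

section \<open>Message passing on a tree\<close>

datatype 'v var = Noise 'v | Msg 'v 'v

primrec var_law :: "'a measure \<Rightarrow> 'a measure \<Rightarrow> 'v var \<Rightarrow> 'a measure" where
  "var_law noise_law msg_law (Noise i) = noise_law"
| "var_law noise_law msg_law (Msg i j) = msg_law"

lemma var_law_map_var: "var_law noise_law msg_law (map_var \<phi> x) = var_law noise_law msg_law x"
  by (cases x) simp_all

context locally_finite_tree
begin

definition vars :: "'v set \<Rightarrow> 'v var set" where
  "vars S = Noise ` S \<union> case_prod Msg ` Sigma S (nbrs adj)"

definition free_vars :: "'v set \<Rightarrow> 'v var set" where
  "free_vars S = Noise ` S \<union> case_prod Msg ` out_arcs adj S"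

definition inputs :: "'v \<Rightarrow> 'v \<Rightarrow> 'v var set" where
  "inputs i j = vars {i} - {Msg i j}"

lemma vars_iff [simp]: "Noise i \<in> vars S \<longleftrightarrow> i \<in> S" "Msg i j \<in> vars S \<longleftrightarrow> i \<in> S \<and> adj i j"
  by (auto simp: vars_def nbrs_def)

lemma free_vars_iff [simp]:
  "Noise i \<in> free_vars S \<longleftrightarrow> i \<in> S" "Msg i j \<in> free_vars S \<longleftrightarrow> i \<in> S \<and> j \<notin> S \<and> adj i j"
  by (auto simp: free_vars_def out_arcs_def nbrs_def)

lemma inputs_iff [simp]:
  "Noise k \<in> inputs i j \<longleftrightarrow> k = i" "Msg k l \<in> inputs i j \<longleftrightarrow> k = i \<and> l \<noteq> j \<and> adj i l"
  by (auto simp: inputs_def)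

lemma vars_mono: "S \<subseteq> T \<Longrightarrow> vars S \<subseteq> vars T"
  by (auto simp: vars_def)

lemma vars_subset_iff: "vars S \<subseteq> vars T \<longleftrightarrow> S \<subseteq> T"
  using vars_mono by (meson subset_iff vars_iff(1))

lemma vars_subset_UNIV: "vars S \<subseteq> vars UNIV"
  by (simp add: vars_mono)

lemma free_vars_subset: "free_vars S \<subseteq> vars S"
  by (auto simp: vars_def free_vars_def out_arcs_def)

lemma inputs_subset_vars: "i \<in> S \<Longrightarrow> inputs i j \<subseteq> vars S"
  using vars_mono[of "{i}" S] by (auto simp: inputs_def)

lemma finite_vars: "S \<in> finite_subtrees \<Longrightarrow> finite (vars S)"
  using finite_nbrs by (simp add: vars_def finite_subtrees_def)

lemma free_vars_nonempty: "S \<noteq> {} \<Longrightarrow> free_vars S \<noteq> {}"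
  using free_vars_iff(1) by blast

lemma free_vars_singleton: "free_vars {i} = vars {i}"
proof (rule set_eqI)
  show "x \<in> free_vars {i} \<longleftrightarrow> x \<in> vars {i}" for x
    using adj_irrefl by (cases x) auto
qed

lemma finite_vars_subset_subtree:
  assumes "finite J" "J \<subseteq> vars UNIV"
  shows "\<exists>S\<in>finite_subtrees. J \<subseteq> vars S"
proof -
  define site where "site = case_var (\<lambda>i. i) (\<lambda>i j. i :: 'v)"
  obtain S where S: "S \<in> finite_subtrees" "site ` J \<subseteq> S"
    using finite_subtree_superset[of "site ` J"] assms(1) by auto
  have "J \<subseteq> vars S"
  proof
    fix x assume "x \<in> J"
    then have "site x \<in> S" "x \<in> vars UNIV" using S assms(2) by auto
    then show "x \<in> vars S" by (cases x) (simp_all add: site_def)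
  qed
  with S show ?thesis by blast
qed

context
  fixes T u v
  assumes T: "T \<in> finite_subtrees" and uv: "u \<in> T" "v \<notin> T" "adj u v"
begin

lemma adj_leaf_iff: "i \<in> T \<Longrightarrow> adj i v \<longleftrightarrow> i = u" "i \<in> T \<Longrightarrow> adj v i \<longleftrightarrow> i = u"
  using unique_nbr_in_connected[of T i u v] T uv adj_sym by (auto simp: finite_subtrees_def)

lemma free_vars_insert: "free_vars (insert v T) = inputs v u \<union> (free_vars T - {Msg u v})"
proof (rule set_eqI)
  show "x \<in> free_vars (insert v T) \<longleftrightarrow> x \<in> inputs v u \<union> (free_vars T - {Msg u v})" for x
    using adj_leaf_iff uv by (cases x) (auto simp: adj_irrefl)
qed

lemma vars_insert: "vars (insert v T) = insert (Msg v u) (vars T \<union> inputs v u)"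
proof (rule set_eqI)
  show "x \<in> vars (insert v T) \<longleftrightarrow> x \<in> insert (Msg v u) (vars T \<union> inputs v u)" for x
    using uv adj_sym by (cases x) auto
qed

end

end

text \<open>\<open>message \<omega> i j\<close> is the value that the recursion at \<open>i\<close> prescribes for \<open>Msg j i\<close>.\<close>

locale message_passing = locally_finite_tree adj
  for adj :: "'v \<Rightarrow> 'v \<Rightarrow> bool" +
  fixes noise_law msg_law :: "'a::{second_countable_topology, t2_space} measure"
    and message :: "('v var \<Rightarrow> 'a) \<Rightarrow> 'v \<Rightarrow> 'v \<Rightarrow> 'a"
  assumes prob_space_noise_law: "prob_space noise_law"
    and sets_noise_law: "sets noise_law = sets borel"
    and prob_space_msg_law: "prob_space msg_law"
    and sets_msg_law: "sets msg_law = sets borel"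
    and message_cong: "adj i j \<Longrightarrow> (\<And>x. x \<in> inputs i j \<Longrightarrow> \<omega> x = \<omega>' x) \<Longrightarrow> message \<omega> i j = message \<omega>' i j"
    and measurable_message_inputs:
      "adj i j \<Longrightarrow> (\<lambda>\<omega>. message \<omega> i j) \<in> borel_measurable (borel_PiM (inputs i j))"
    and distr_message:
      "adj i j \<Longrightarrow>
        distr (PiM (inputs i j) (var_law noise_law msg_law)) borel (\<lambda>\<omega>. message \<omega> i j) = msg_law"
    and message_relabel:
      "automorphism adj \<phi> \<Longrightarrow> adj i j \<Longrightarrow> message (\<lambda>x. \<omega> (map_var \<phi> x)) i j = message \<omega> (\<phi> i) (\<phi> j)"
begin

abbreviation law :: "'v var \<Rightarrow> 'a measure" where
  "law \<equiv> var_law noise_law msg_law"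

lemma prob_space_law: "prob_space (law x)"
  by (cases x) (simp_all add: prob_space_noise_law prob_space_msg_law)

lemma sets_law: "sets (law x) = sets borel"
  by (cases x) (simp_all add: sets_noise_law sets_msg_law)

lemma sets_PiM_law: "sets (PiM J law) = sets (borel_PiM J)"
  by (intro sets_PiM_cong) (simp_all add: sets_law)

lemma space_PiM_law: "space (PiM J law) = extensional J"
  using sets_eq_imp_space_eq[OF sets_PiM_law] by (simp only: space_borel_PiM)

lemma distr_PiM_law_coord:
  assumes "x \<in> J"
  shows "distr (PiM J law) borel (\<lambda>g. g x) = law x"
proof -
  have "distr (PiM J law) borel (\<lambda>g. g x) = distr (PiM J law) (law x) (\<lambda>g. g x)"
    by (intro distr_cong) (simp_all add: sets_law)
  also have "\<dots> = law x"
    using assms by (intro distr_PiM_component prob_space_law)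
  finally show ?thesis .
qed

lemma measurable_message:
  assumes "adj i j" "inputs i j \<subseteq> J" and f: "f \<in> measurable N (borel_PiM J)"
  shows "(\<lambda>x. message (f x) i j) \<in> borel_measurable N"
proof -
  have "(\<lambda>x. message (restrict (f x) (inputs i j)) i j) \<in> borel_measurable N"
    using assms by (intro measurable_compose[OF measurable_compose[OF f measurable_restrict_subset]
      measurable_message_inputs])
  moreover have "message (restrict (f x) (inputs i j)) i j = message (f x) i j" for x
    by (rule message_cong[OF assms(1)]) simp
  ultimately show ?thesis by simp
qed

definition recursive_on :: "'v set \<Rightarrow> ('v var \<Rightarrow> 'a) \<Rightarrow> bool" where
  "recursive_on S \<omega> \<longleftrightarrow> (\<forall>i\<in>S. \<forall>j\<in>S. adj i j \<longrightarrow> \<omega> (Msg j i) = message \<omega> i j)"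

lemma recursive_on_cong:
  assumes "\<And>x. x \<in> vars S \<Longrightarrow> \<omega> x = \<omega>' x"
  shows "recursive_on S \<omega> \<longleftrightarrow> recursive_on S \<omega>'"
proof -
  have "message \<omega> i j = message \<omega>' i j" if "i \<in> S" "adj i j" for i j
    using that(2) assms inputs_subset_vars[OF that(1)] by (blast intro: message_cong)
  then show ?thesis using assms adj_sym by (simp add: recursive_on_def)
qed

lemma recursive_on_insert:
  assumes "T \<in> finite_subtrees" "u \<in> T" "v \<notin> T" "adj u v"
  shows "recursive_on (insert v T) \<omega> \<longleftrightarrow>
    recursive_on T \<omega> \<and> \<omega> (Msg u v) = message \<omega> v u \<and> \<omega> (Msg v u) = message \<omega> u v"
proof -
  have "(\<forall>i\<in>insert v T. \<forall>j\<in>insert v T. adj i j \<longrightarrow> P i j) \<longleftrightarrow>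
      (\<forall>i\<in>T. \<forall>j\<in>T. adj i j \<longrightarrow> P i j) \<and> P v u \<and> P u v" for P
    using adj_leaf_iff[OF assms] assms adj_irrefl adj_sym by (auto 4 3)
  then show ?thesis unfolding recursive_on_def .
qed

definition completes :: "'v set \<Rightarrow> (('v var \<Rightarrow> 'a) \<Rightarrow> 'v var \<Rightarrow> 'a) \<Rightarrow> bool" where
  "completes S C \<longleftrightarrow>
     C \<in> measurable (borel_PiM (free_vars S)) (borel_PiM (vars S)) \<and>
     (\<forall>g. \<forall>x\<in>free_vars S. C g x = g x) \<and>
     (\<forall>\<omega>. recursive_on S \<omega> \<longleftrightarrow> restrict \<omega> (vars S) = C (restrict \<omega> (free_vars S)))"

lemma completes_extensional:
  assumes "completes S C" "g \<in> extensional (free_vars S)"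
  shows "C g \<in> extensional (vars S)"
  using assms measurable_space[of C "borel_PiM (free_vars S)" "borel_PiM (vars S)" g]
  by (simp add: completes_def space_borel_PiM)

lemma completes_singleton: "completes {i} (\<lambda>g. g)"
  by (simp add: completes_def free_vars_singleton recursive_on_def adj_irrefl)

context
  fixes T u v
  assumes T: "T \<in> finite_subtrees" and uv: "u \<in> T" "v \<notin> T" "adj u v"
begin

definition absorb :: "('v var \<Rightarrow> 'a) \<Rightarrow> 'v var \<Rightarrow> 'a" where
  "absorb g = (\<lambda>x\<in>free_vars T. if x = Msg u v then message g v u else g x)"

lemma inputs_subset_free_vars_insert: "inputs v u \<subseteq> free_vars (insert v T)"
  using free_vars_insert[OF T uv] by blast

lemma measurable_absorb:
  "absorb \<in> measurable (borel_PiM (free_vars (insert v T))) (borel_PiM (free_vars T))"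
  unfolding absorb_def[abs_def]
proof (rule measurable_restrict)
  fix x assume "x \<in> free_vars T"
  then show "(\<lambda>g. if x = Msg u v then message g v u else g x)
      \<in> borel_measurable (borel_PiM (free_vars (insert v T)))"
    using measurable_message[OF adj_sym[OF uv(3)] inputs_subset_free_vars_insert measurable_ident]
    by (cases "x = Msg u v") (simp_all add: free_vars_insert[OF T uv])
qed

lemma message_restrict_free_vars_insert:
  "message (restrict \<omega> (free_vars (insert v T))) v u = message \<omega> v u"
  using inputs_subset_free_vars_insert by (intro message_cong adj_sym[OF uv(3)]) auto

lemma absorb_restrict:
  assumes "\<omega> (Msg u v) = message \<omega> v u"
  shows "absorb (restrict \<omega> (free_vars (insert v T))) = restrict \<omega> (free_vars T)"
  using assms unfolding absorb_def message_restrict_free_vars_insert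
  by (auto simp: free_vars_insert[OF T uv] fun_eq_iff)

lemma distr_absorb:
  "distr (PiM (free_vars (insert v T)) law) (borel_PiM (free_vars T)) absorb
    = PiM (free_vars T) law"
proof -
  define block where "block x = (if x = Msg u v then inputs v u else {x})" for x
  define block_map where "block_map x g = (if x = Msg u v then message g v u else g x)" for x g
  have block_subset: "block x \<subseteq> free_vars (insert v T)" if "x \<in> free_vars T" for x
    using that by (auto simp: block_def free_vars_insert[OF T uv])
  have block_disjoint: "disjoint_family_on block (free_vars T)"
  proof -
    have "inputs v u \<inter> free_vars T = {}"
      using uv(2) by (auto simp: inputs_def vars_def)
    then show ?thesis by (auto simp: block_def disjoint_family_on_def)
  qed
  have block_map_measurable: "block_map x \<in> borel_measurable (PiM (block x) law)" for x
    using measurable_message_inputs[OF adj_sym[OF uv(3)]]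
    by (auto simp: block_map_def[abs_def] block_def sets_PiM_law cong: measurable_cong_sets)
  have block_map_law: "distr (PiM (block x) law) borel (block_map x) = law x" for x
    by (cases "x = Msg u v")
      (simp_all add: block_def block_map_def[abs_def] distr_message
          adj_sym[OF uv(3)] distr_PiM_law_coord)
  have "block_map x (restrict g (block x)) = (if x = Msg u v then message g v u else g x)" for x g
    by (auto simp: block_map_def block_def intro!: message_cong adj_sym[OF uv(3)])
  then have "distr (PiM (free_vars (insert v T)) law) (borel_PiM (free_vars T)) absorb
      = distr (PiM (free_vars (insert v T)) law) (borel_PiM (free_vars T))
          (\<lambda>g. \<lambda>x\<in>free_vars T. block_map x (restrict g (block x)))"
    by (simp add: absorb_def[abs_def])
  also have "\<dots> = (\<Pi>\<^sub>M x\<in>free_vars T. distr (PiM (block x) law) borel (block_map x))"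
    using uv(1) free_vars_nonempty
    by (intro distr_PiM_disjoint_blocks prob_space_law block_subset block_disjoint
        block_map_measurable) auto
  finally show ?thesis by (simp add: block_map_law)
qed

text \<open>The message along \<open>(u, v)\<close> comes from outside data, then \<open>C\<close> completes \<open>T\<close>, and the
  message along \<open>(v, u)\<close> is read off from the result.\<close>

definition extend_completion ::
    "(('v var \<Rightarrow> 'a) \<Rightarrow> 'v var \<Rightarrow> 'a) \<Rightarrow> ('v var \<Rightarrow> 'a) \<Rightarrow> 'v var \<Rightarrow> 'a" where
  "extend_completion C g = (\<lambda>x\<in>vars (insert v T).
     if x \<in> vars T then C (absorb g) x
     else if x = Msg v u then message (C (absorb g)) u v
     else g x)"

lemma measurable_extend_completion:
  assumes "C \<in> measurable (borel_PiM (free_vars T)) (borel_PiM (vars T))"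
  shows "extend_completion C
    \<in> measurable (borel_PiM (free_vars (insert v T))) (borel_PiM (vars (insert v T)))"
  unfolding extend_completion_def[abs_def]
proof (rule measurable_restrict)
  fix x assume x: "x \<in> vars (insert v T)"
  note C_absorb = measurable_compose[OF measurable_absorb assms]
  have "x \<in> free_vars (insert v T)" if "x \<notin> vars T" "x \<noteq> Msg v u"
    using x that by (auto simp: free_vars_insert[OF T uv] vars_insert[OF T uv])
  then show "(\<lambda>g. if x \<in> vars T then C (absorb g) x
      else if x = Msg v u then message (C (absorb g)) u v else g x)
      \<in> borel_measurable (borel_PiM (free_vars (insert v T)))"
    using measurable_message[OF uv(3) inputs_subset_vars[OF uv(1)] C_absorb]
      measurable_compose[OF C_absorb measurable_component_singleton[of x]]
    by (cases "x \<in> vars T"; cases "x = Msg v u") (simp_all del: vars_iff)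
qed

lemma extend_completion_free_vars:
  assumes C: "\<And>g x. x \<in> free_vars T \<Longrightarrow> C g x = g x" and x: "x \<in> free_vars (insert v T)"
  shows "extend_completion C g x = g x"
proof -
  have "x \<noteq> Msg u v" "x \<noteq> Msg v u" using x uv by auto
  moreover have "x \<in> free_vars T" if "x \<in> vars T"
    using x that uv by (cases x) auto
  ultimately show ?thesis
    using x free_vars_subset by (auto simp: extend_completion_def absorb_def C)
qed

lemma restrict_eq_extend_completion_iff:
  assumes C: "completes T C" and g: "g = restrict \<omega> (free_vars (insert v T))"
  shows "restrict \<omega> (vars (insert v T)) = extend_completion C g \<longleftrightarrow>
    restrict \<omega> (vars T) = C (absorb g) \<and> \<omega> (Msg v u) = message (C (absorb g)) u v"
    (is "?extend \<longleftrightarrow> ?complete \<and> ?read_off")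
proof (intro iffI conjI)
  assume ?extend
  then have eq: "\<omega> x = extend_completion C g x" if "x \<in> vars (insert v T)" for x
    using that by (metis restrict_apply')
  have "C (absorb g) \<in> extensional (vars T)"
    using C by (rule completes_extensional) (simp add: absorb_def)
  then have "restrict \<omega> (vars T) x = C (absorb g) x" for x
    using eq[of x] vars_insert[OF T uv]
    by (cases "x \<in> vars T") (simp_all add: extend_completion_def extensional_def)
  then show ?complete by (rule ext)
  show ?read_off
    using eq[of "Msg v u"] uv adj_sym by (simp add: extend_completion_def)
next
  assume complete: "?complete \<and> ?read_off"
  show ?extend
  proof
    fix x
    have "x \<in> free_vars (insert v T)" if "x \<in> vars (insert v T)" "x \<notin> vars T" "x \<noteq> Msg v u"
      using that by (auto simp: free_vars_insert[OF T uv] vars_insert[OF T uv])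
    moreover have "C (absorb g) x = \<omega> x" if "x \<in> vars T"
      using complete that by (metis restrict_apply')
    ultimately show "restrict \<omega> (vars (insert v T)) x = extend_completion C g x"
      using complete by (simp add: extend_completion_def g)
  qed
qed

lemma recursive_on_insert_iff_extend_completion:
  assumes C: "completes T C"
  shows "recursive_on (insert v T) \<omega> \<longleftrightarrow>
    restrict \<omega> (vars (insert v T)) = extend_completion C (restrict \<omega> (free_vars (insert v T)))"
proof -
  define g where "g = restrict \<omega> (free_vars (insert v T))"
  note extend_iff = restrict_eq_extend_completion_iff[OF C g_def]
  have C_rec: "recursive_on T \<omega> \<longleftrightarrow> restrict \<omega> (vars T) = C (restrict \<omega> (free_vars T))"
    using C by (simp add: completes_def)
  have message_uv: "message (restrict \<omega> (vars T)) u v = message \<omega> u v"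
    using inputs_subset_vars[OF uv(1)] by (intro message_cong uv) auto
  show ?thesis
  proof (cases "\<omega> (Msg u v) = message \<omega> v u")
    case True
    then have "absorb g = restrict \<omega> (free_vars T)" unfolding g_def by (rule absorb_restrict)
    then show ?thesis
      unfolding recursive_on_insert[OF T uv] g_def[symmetric] extend_iff C_rec
      using True message_uv by auto
  next
    case False
    have "Msg u v \<in> free_vars T" using uv by simp
    then have "C (absorb g) (Msg u v) = message \<omega> v u"
      using C message_restrict_free_vars_insert by (simp add: completes_def absorb_def g_def)
    moreover have "restrict \<omega> (vars T) (Msg u v) = \<omega> (Msg u v)" using uv by simp
    ultimately have "restrict \<omega> (vars T) \<noteq> C (absorb g)" using False by metis
    then show ?thesis
      unfolding recursive_on_insert[OF T uv] g_def[symmetric] extend_iff using False by blast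
  qed
qed

lemma completes_extend_completion:
  assumes "completes T C"
  shows "completes (insert v T) (extend_completion C)"
  unfolding completes_def[of "insert v T"]
proof (intro conjI allI ballI)
  show "extend_completion C
      \<in> measurable (borel_PiM (free_vars (insert v T))) (borel_PiM (vars (insert v T)))"
    using assms by (intro measurable_extend_completion) (simp add: completes_def)
  show "extend_completion C g x = g x" if "x \<in> free_vars (insert v T)" for g x
    using assms that by (intro extend_completion_free_vars) (simp_all add: completes_def)
qed (rule recursive_on_insert_iff_extend_completion[OF assms])

end

lemma exists_completion:
  assumes S: "S \<in> finite_subtrees"
  shows "\<exists>C. completes S C"
proof -
  obtain s where "s \<in> S" using S by (auto simp: finite_subtrees_def)
  then have "{s} \<subseteq> S" by simp
  with S singleton_finite_subtree show ?thesis
  proof (induction rule: finite_subtree_induct)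
    case base
    show ?case using completes_singleton by blast
  next
    case (step T u v)
    then show ?case using completes_extend_completion by blast
  qed
qed

definition completion_map :: "'v set \<Rightarrow> ('v var \<Rightarrow> 'a) \<Rightarrow> 'v var \<Rightarrow> 'a" where
  "completion_map S = (SOME C. completes S C)"

lemma completes_completion_map: "S \<in> finite_subtrees \<Longrightarrow> completes S (completion_map S)"
  unfolding completion_map_def by (rule someI_ex[OF exists_completion])

lemma measurable_completion_map:
  "S \<in> finite_subtrees \<Longrightarrow>
    completion_map S \<in> measurable (borel_PiM (free_vars S)) (borel_PiM (vars S))"
  using completes_completion_map by (auto simp: completes_def)

lemma measurable_completion_map_law:
  "S \<in> finite_subtrees \<Longrightarrow> completion_map S \<in> measurable (PiM (free_vars S) law) (borel_PiM (vars S))"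
  using measurable_completion_map by (simp add: sets_PiM_law cong: measurable_cong_sets)

lemma completion_map_extensional:
  "S \<in> finite_subtrees \<Longrightarrow> g \<in> extensional (free_vars S) \<Longrightarrow> completion_map S g \<in> extensional (vars S)"
  using completes_completion_map by (rule completes_extensional)

lemma completion_map_free_vars:
  "S \<in> finite_subtrees \<Longrightarrow> x \<in> free_vars S \<Longrightarrow> completion_map S g x = g x"
  using completes_completion_map by (auto simp: completes_def)

lemma recursive_on_iff_completion_map:
  "S \<in> finite_subtrees \<Longrightarrow>
    recursive_on S \<omega> \<longleftrightarrow> restrict \<omega> (vars S) = completion_map S (restrict \<omega> (free_vars S))"
  using completes_completion_map by (auto simp: completes_def)

lemma recursive_on_completion_map:
  assumes S: "S \<in> finite_subtrees" and g: "g \<in> extensional (free_vars S)"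
  shows "recursive_on S (completion_map S g)"
proof -
  have "restrict (completion_map S g) (free_vars S) = g"
    using g by (auto simp: completion_map_free_vars[OF S] extensional_def fun_eq_iff)
  then show ?thesis
    by (simp add: recursive_on_iff_completion_map[OF S]
        completion_map_extensional[OF assms] extensional_restrict)
qed

lemma sets_recursive_on:
  assumes S: "S \<in> finite_subtrees" and K: "vars S \<subseteq> K"
  shows "{g \<in> space (borel_PiM K). recursive_on S g} \<in> sets (borel_PiM K)"
proof -
  let ?C = "\<lambda>g. completion_map S (restrict g (free_vars S))"
  have "(\<lambda>g. restrict g (free_vars S)) \<in> measurable (borel_PiM K) (borel_PiM (free_vars S))"
    using free_vars_subset K by (intro measurable_restrict_subset) blast
  note C_measurable = measurable_compose[OF this measurable_completion_map[OF S]]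
  have coordinate_sets: "{g \<in> space (borel_PiM K). g x = ?C g x} \<in> sets (borel_PiM K)"
    if "x \<in> vars S" for x
    using that K measurable_compose[OF C_measurable measurable_component_singleton[OF that]]
    by (intro measurable_equality_set measurable_component_singleton) auto
  have recursive_on_eq: "recursive_on S = (\<lambda>g. \<forall>x\<in>vars S. g x = ?C g x)"
  proof (rule ext)
    fix g :: "'v var \<Rightarrow> 'a"
    have "?C g \<in> extensional (vars S)" by (intro completion_map_extensional S restrict_extensional)
    then show "recursive_on S g \<longleftrightarrow> (\<forall>x\<in>vars S. g x = ?C g x)"
      by (auto simp: recursive_on_iff_completion_map[OF S] extensional_def fun_eq_iff restrict_def)
  qed
  show ?thesis
    unfolding recursive_on_eq by (intro sets.sets_Collect_finite_All finite_vars S coordinate_sets)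
qed

section \<open>Consistent laws on finite subtrees\<close>

definition local_law :: "'v set \<Rightarrow> ('v var \<Rightarrow> 'a) measure" where
  "local_law S = distr (PiM (free_vars S) law) (borel_PiM (vars S)) (completion_map S)"

lemma sets_local_law [simp]: "sets (local_law S) = sets (borel_PiM (vars S))"
  by (simp add: local_law_def)

lemma prob_space_local_law: "S \<in> finite_subtrees \<Longrightarrow> prob_space (local_law S)"
  unfolding local_law_def
  by (intro prob_space.prob_space_distr prob_space_PiM prob_space_law measurable_completion_map_law)

lemma marginal_free_vars_local_law:
  assumes S: "S \<in> finite_subtrees"
  shows "marginal (free_vars S) (local_law S) = PiM (free_vars S) law"
proof -
  have "marginal (free_vars S) (local_law S)
      = distr (PiM (free_vars S) law) (borel_PiM (free_vars S))
          (\<lambda>g. restrict (completion_map S g) (free_vars S))"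
    unfolding marginal_def local_law_def
    by (subst distr_distr[OF measurable_restrict_subset[OF free_vars_subset]
        measurable_completion_map_law[OF S]])
      (simp add: comp_def)
  also have "\<dots> = marginal (free_vars S) (PiM (free_vars S) law)"
    unfolding marginal_def
    by (intro distr_cong restrict_ext) (simp_all add: completion_map_free_vars[OF S])
  also have "\<dots> = PiM (free_vars S) law"
    by (rule marginal_self) (rule sets_PiM_law)
  finally show ?thesis .
qed

lemma AE_local_law_recursive_on:
  assumes S: "S \<in> finite_subtrees"
  shows "AE g in local_law S. recursive_on S g"
  unfolding local_law_def
  by (subst AE_distr_iff[OF measurable_completion_map_law[OF S] sets_recursive_on[OF S order_refl]])
    (intro AE_I2 recursive_on_completion_map[OF S], simp add: space_PiM_law)

lemma marginal_eq_local_lawI: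
  assumes S: "S \<in> finite_subtrees" and Q: "sets Q = sets (borel_PiM K)" "vars S \<subseteq> K"
    and free: "marginal (free_vars S) Q = PiM (free_vars S) law"
    and recursive: "AE \<omega> in Q. recursive_on S \<omega>"
  shows "marginal (vars S) Q = local_law S"
proof -
  have restrict_measurable: "(\<lambda>\<omega>. restrict \<omega> (free_vars S))
      \<in> measurable Q (borel_PiM (free_vars S))"
    using free_vars_subset Q(2) by (intro measurable_restrict_coords[OF Q(1)]) blast
  have "marginal (vars S) Q
      = distr Q (borel_PiM (vars S)) (\<lambda>\<omega>. completion_map S (restrict \<omega> (free_vars S)))"
    unfolding marginal_def
  proof (rule distr_cong_AE)
    show "AE \<omega> in Q. restrict \<omega> (vars S) = completion_map S (restrict \<omega> (free_vars S))"
      using recursive by (simp add: recursive_on_iff_completion_map[OF S])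
  qed (use measurable_restrict_coords[OF Q]
      measurable_compose[OF restrict_measurable measurable_completion_map[OF S]] in auto)
  also have "\<dots> = distr (marginal (free_vars S) Q) (borel_PiM (vars S)) (completion_map S)"
    unfolding marginal_def
    by (subst distr_distr[OF measurable_completion_map[OF S] restrict_measurable])
      (simp add: comp_def)
  finally show ?thesis by (simp add: free local_law_def)
qed

lemma
  assumes S: "S \<in> finite_subtrees" and Q: "sets Q = sets (borel_PiM K)" "vars S \<subseteq> K"
    and eq: "marginal (vars S) Q = local_law S"
  shows marginal_free_vars_eq_PiM: "marginal (free_vars S) Q = PiM (free_vars S) law"
    and AE_recursive_on: "AE \<omega> in Q. recursive_on S \<omega>"
proof -
  show "marginal (free_vars S) Q = PiM (free_vars S) law"
    using marginal_marginal[OF Q(1) free_vars_subset Q(2)]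
      marginal_free_vars_local_law[OF S] eq by simp
  have "AE g in marginal (vars S) Q. recursive_on S g"
    unfolding eq by (rule AE_local_law_recursive_on[OF S])
  then have "AE \<omega> in Q. recursive_on S (restrict \<omega> (vars S))"
    unfolding marginal_def by (rule AE_distrD[OF measurable_restrict_coords[OF Q]])
  moreover have "recursive_on S (restrict \<omega> (vars S)) \<longleftrightarrow> recursive_on S \<omega>" for \<omega>
    by (rule recursive_on_cong) simp
  ultimately show "AE \<omega> in Q. recursive_on S \<omega>" by simp
qed

lemma local_law_remove_leaf:
  assumes T: "T \<in> finite_subtrees" and uv: "u \<in> T" "v \<notin> T" "adj u v"
  shows "marginal (vars T) (local_law (insert v T)) = local_law T"
proof (rule marginal_eq_local_lawI[OF T sets_local_law])
  let ?S = "insert v T"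
  let ?Q = "local_law ?S"
  have S: "?S \<in> finite_subtrees" using T uv by (blast intro: insert_finite_subtree)
  have recursive: "AE \<omega> in ?Q. recursive_on T \<omega> \<and> \<omega> (Msg u v) = message \<omega> v u"
    using AE_local_law_recursive_on[OF S] by (simp add: recursive_on_insert[OF assms])
  then show "AE \<omega> in ?Q. recursive_on T \<omega>" by (rule eventually_mono) blast
  show T_subset: "vars T \<subseteq> vars ?S" by (simp add: vars_mono subset_insertI)
  note free_T_measurable =
    measurable_restrict_coords[OF sets_local_law order_trans[OF free_vars_subset T_subset]]
  note free_S_measurable = measurable_restrict_coords[OF sets_local_law free_vars_subset]
  have "marginal (free_vars T) ?Q
      = distr ?Q (borel_PiM (free_vars T)) (\<lambda>\<omega>. absorb T u v (restrict \<omega> (free_vars ?S)))"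
    unfolding marginal_def
  proof (rule distr_cong_AE)
    show "AE \<omega> in ?Q. restrict \<omega> (free_vars T) = absorb T u v (restrict \<omega> (free_vars ?S))"
      using recursive by (rule eventually_mono) (simp add: absorb_restrict[OF assms])
  qed (use free_T_measurable
      measurable_compose[OF free_S_measurable measurable_absorb[OF assms]] in auto)
  also have "\<dots> = distr (marginal (free_vars ?S) ?Q) (borel_PiM (free_vars T)) (absorb T u v)"
    unfolding marginal_def
    by (subst distr_distr[OF measurable_absorb[OF assms] free_S_measurable]) (simp add: comp_def)
  also have "\<dots> = PiM (free_vars T) law"
    by (simp add: marginal_free_vars_local_law[OF S] distr_absorb[OF assms])
  finally show "marginal (free_vars T) ?Q = PiM (free_vars T) law" .
qed

lemma local_law_consistent:
  assumes S: "S \<in> finite_subtrees" and T: "T \<in> finite_subtrees" "T \<subseteq> S"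
  shows "marginal (vars T) (local_law S) = local_law T"
proof -
  from S T have "T \<subseteq> S \<and> marginal (vars T) (local_law S) = local_law T"
  proof (induction rule: finite_subtree_induct)
    case base
    show ?case by (simp add: marginal_self)
  next
    case (step H u v)
    have "marginal (vars T) (local_law (insert v H))
        = marginal (vars T) (marginal (vars H) (local_law (insert v H)))"
      using step by (intro marginal_marginal[symmetric, OF sets_local_law] vars_mono) auto
    then show ?case using step by (auto simp: local_law_remove_leaf)
  qed
  then show ?thesis by blast
qed

section \<open>The law on the whole tree\<close>

lemma cofinal_projective_family_local_law:
  "cofinal_projective_family (vars UNIV) finite_subtrees vars local_law"
  by (rule cofinal_projective_family.intro)
    (simp_all add: vars_subset_iff finite_vars_subset_subtree local_law_consistent
      prob_space_local_law finite_vars vars_subset_UNIV)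

definition tree_law :: "('v var \<Rightarrow> 'a) measure \<Rightarrow> bool" where
  "tree_law Q \<longleftrightarrow> prob_space Q \<and> sets Q = sets (borel_PiM (vars UNIV)) \<and>
     (\<forall>S\<in>finite_subtrees. marginal (vars S) Q = local_law S)"

lemma tree_law_exists:
  fixes enc :: "'a \<Rightarrow> 'b::polish_space"
  assumes "enc \<in> borel_measurable borel" "dec \<in> borel_measurable borel" "\<And>x. dec (enc x) = x"
  obtains Q where "tree_law Q"
proof (rule embedded_extension_exists[OF cofinal_projective_family_local_law assms])
  fix Q
  assume "prob_space Q" "sets Q = sets (borel_PiM (vars UNIV))"
    and "\<And>S. S \<in> finite_subtrees \<Longrightarrow> marginal (vars S) Q = local_law S"
  then show thesis by (intro that[of Q]) (simp add: tree_law_def)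
qed

lemma tree_law_unique: "tree_law Q \<Longrightarrow> tree_law Q' \<Longrightarrow> Q = Q'"
  using cofinal_projective_family.unique_extension[OF cofinal_projective_family_local_law]
  by (auto simp: tree_law_def)

definition relabel_vars :: "('v \<Rightarrow> 'v) \<Rightarrow> ('v var \<Rightarrow> 'a) \<Rightarrow> 'v var \<Rightarrow> 'a" where
  "relabel_vars \<phi> \<omega> = (\<lambda>x\<in>vars UNIV. \<omega> (map_var \<phi> x))"

context
  fixes \<phi> :: "'v \<Rightarrow> 'v"
  assumes \<phi>: "automorphism adj \<phi>"
begin

lemma finite_subtree_image: "S \<in> finite_subtrees \<Longrightarrow> \<phi> ` S \<in> finite_subtrees"
  by (auto simp: finite_subtrees_def intro: connected_image[OF \<phi>])

lemma map_var_vars_UNIV: "x \<in> vars UNIV \<Longrightarrow> map_var \<phi> x \<in> vars UNIV"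
  by (cases x) (simp_all add: adj_automorphism_iff[OF \<phi>])

lemma map_var_free_vars: "x \<in> free_vars S \<Longrightarrow> map_var \<phi> x \<in> free_vars (\<phi> ` S)"
  by (cases x) (auto simp: adj_automorphism_iff[OF \<phi>] inj_image_mem_iff[OF inj_automorphism[OF \<phi>]])

lemma measurable_relabel_vars:
  "relabel_vars \<phi> \<in> measurable (borel_PiM (vars UNIV)) (borel_PiM (vars UNIV))"
  unfolding relabel_vars_def[abs_def]
  by (intro measurable_restrict measurable_component_singleton map_var_vars_UNIV)

lemma recursive_on_relabel_vars:
  assumes "recursive_on (\<phi> ` S) \<omega>"
  shows "recursive_on S (relabel_vars \<phi> \<omega>)"
  unfolding recursive_on_def
proof (intro ballI impI)
  fix i j assume ij: "i \<in> S" "j \<in> S" "adj i j"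
  have "message (relabel_vars \<phi> \<omega>) i j = message (\<lambda>x. \<omega> (map_var \<phi> x)) i j"
    using inputs_subset_vars[of i UNIV j]
    by (intro message_cong ij) (auto simp: relabel_vars_def)
  also have "\<dots> = message \<omega> (\<phi> i) (\<phi> j)"
    by (rule message_relabel[OF \<phi> ij(3)])
  also have "\<dots> = \<omega> (Msg (\<phi> j) (\<phi> i))"
    using assms ij by (simp add: recursive_on_def adj_automorphism_iff[OF \<phi>])
  finally show "relabel_vars \<phi> \<omega> (Msg j i) = message (relabel_vars \<phi> \<omega>) i j"
    using adj_sym[OF ij(3)] by (simp add: relabel_vars_def)
qed

lemma marginal_free_vars_relabel:
  assumes Q: "sets Q = sets (borel_PiM (vars UNIV))"
    and free: "marginal (free_vars (\<phi> ` S)) Q = PiM (free_vars (\<phi> ` S)) law"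
  shows "marginal (free_vars S) (distr Q (borel_PiM (vars UNIV)) (relabel_vars \<phi>))
    = PiM (free_vars S) law"
proof -
  let ?pullback = "\<lambda>g. \<lambda>x\<in>free_vars S. g (map_var \<phi> x)"
  have relabel_measurable: "relabel_vars \<phi> \<in> measurable Q (borel_PiM (vars UNIV))"
    using measurable_relabel_vars Q by (simp cong: measurable_cong_sets)
  have pullback_measurable:
    "?pullback \<in> measurable (borel_PiM (free_vars (\<phi> ` S))) (borel_PiM (free_vars S))"
    by (intro measurable_restrict measurable_component_singleton map_var_free_vars)
  have free_UNIV: "free_vars H \<subseteq> vars UNIV" for H
    using free_vars_subset vars_subset_UNIV by blast
  have "marginal (free_vars S) (distr Q (borel_PiM (vars UNIV)) (relabel_vars \<phi>))
      = distr Q (borel_PiM (free_vars S)) (\<lambda>\<omega>. ?pullback (restrict \<omega> (free_vars (\<phi> ` S))))"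
    unfolding marginal_def
  proof (subst distr_distr[OF measurable_restrict_subset[OF free_UNIV] relabel_measurable],
      rule distr_cong)
    show "((\<lambda>\<omega>. restrict \<omega> (free_vars S)) \<circ> relabel_vars \<phi>) \<omega>
        = ?pullback (restrict \<omega> (free_vars (\<phi> ` S)))" for \<omega>
      using map_var_free_vars free_UNIV[of S] by (auto simp: relabel_vars_def fun_eq_iff)
  qed auto
  also have "\<dots> = distr (PiM (free_vars (\<phi> ` S)) law) (borel_PiM (free_vars S)) ?pullback"
    unfolding free[symmetric] marginal_def
    by (subst distr_distr[OF pullback_measurable measurable_restrict_coords[OF Q free_UNIV]])
      (simp add: comp_def)
  also have "\<dots> = distr (PiM (free_vars (\<phi> ` S)) law) (\<Pi>\<^sub>M x\<in>free_vars S. law (map_var \<phi> x))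
      ?pullback"
    by (intro distr_cong) (simp_all add: var_law_map_var sets_PiM_law)
  also have "\<dots> = PiM (free_vars S) law"
    using map_var_free_vars inj_on_subset[OF var.inj_map[OF inj_automorphism[OF \<phi>]]]
    by (subst distr_PiM_reindex) (auto simp: prob_space_law var_law_map_var)
  finally show ?thesis .
qed

lemma tree_law_invariant:
  assumes "tree_law Q"
  shows "distr Q (borel_PiM (vars UNIV)) (relabel_vars \<phi>) = Q" (is "?Q' = Q")
proof (rule tree_law_unique[OF _ assms])
  have Q: "prob_space Q" "sets Q = sets (borel_PiM (vars UNIV))"
    and local: "\<And>S. S \<in> finite_subtrees \<Longrightarrow> marginal (vars S) Q = local_law S"
    using assms by (simp_all add: tree_law_def)
  have relabel_measurable: "relabel_vars \<phi> \<in> measurable Q (borel_PiM (vars UNIV))"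
    using measurable_relabel_vars Q(2) by (simp cong: measurable_cong_sets)
  have "marginal (vars S) ?Q' = local_law S" if S: "S \<in> finite_subtrees" for S
  proof (rule marginal_eq_local_lawI[OF S sets_distr vars_subset_UNIV])
    note S_image = finite_subtree_image[OF S]
    note Q_image = S_image Q(2) vars_subset_UNIV local[OF S_image]
    show "marginal (free_vars S) ?Q' = PiM (free_vars S) law"
      by (intro marginal_free_vars_relabel Q marginal_free_vars_eq_PiM[OF Q_image])
    have "AE \<omega> in Q. recursive_on S (relabel_vars \<phi> \<omega>)"
      using AE_recursive_on[OF Q_image] by (rule eventually_mono) (rule recursive_on_relabel_vars)
    then show "AE \<omega> in ?Q'. recursive_on S \<omega>"
      by (subst AE_distr_iff[OF relabel_measurable sets_recursive_on[OF S vars_subset_UNIV]])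
  qed
  then show "tree_law ?Q'"
    using prob_space.prob_space_distr[OF Q(1) relabel_measurable] by (simp add: tree_law_def)
qed

end

lemma tree_law_distr_coord:
  assumes "tree_law Q" "x \<in> vars UNIV"
  shows "distr Q borel (\<lambda>\<omega>. \<omega> x) = law x"
proof -
  obtain i where i: "x \<in> vars {i}" using assms(2) by (cases x) auto
  have Q: "sets Q = sets (borel_PiM (vars UNIV))" "marginal (vars {i}) Q = local_law {i}"
    using assms(1) singleton_finite_subtree by (simp_all add: tree_law_def)
  have "distr Q borel (\<lambda>\<omega>. \<omega> x) = distr (marginal (vars {i}) Q) borel (\<lambda>\<omega>. \<omega> x)"
    by (rule distr_coord_eq_distr_marginal[OF Q(1) i vars_subset_UNIV])
  also have "marginal (vars {i}) Q = PiM (vars {i}) law"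
    using marginal_free_vars_eq_PiM[OF singleton_finite_subtree Q(1) vars_subset_UNIV Q(2)]
    by (simp add: free_vars_singleton)
  also have "distr (PiM (vars {i}) law) borel (\<lambda>\<omega>. \<omega> x) = law x"
    using i by (rule distr_PiM_law_coord)
  finally show ?thesis .
qed

lemma tree_law_indep_vars:
  assumes "tree_law Q" and S: "finite S" "connected_set adj S"
  shows "prob_space.indep_vars Q (\<lambda>_. borel) (\<lambda>x \<omega>. \<omega> x) (free_vars S)"
proof -
  have Q: "sets Q = sets (borel_PiM (vars UNIV))" using assms by (simp add: tree_law_def)
  interpret prob_space Q using assms by (simp add: tree_law_def)
  show ?thesis
  proof (cases "S = {}")
    case True
    then have "free_vars S = {}" by (simp add: free_vars_def out_arcs_def)
    then show ?thesis by (simp add: indep_vars_def indep_sets_def)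
  next
    case False
    have free_UNIV: "free_vars S \<subseteq> vars UNIV" using free_vars_subset vars_subset_UNIV by blast
    have "S \<in> finite_subtrees" using S False by (simp add: finite_subtrees_def)
    then have "marginal (free_vars S) Q = PiM (free_vars S) law"
      using assms(1)
      by (intro marginal_free_vars_eq_PiM[OF _ Q vars_subset_UNIV]) (simp_all add: tree_law_def)
    also have "\<dots> = (\<Pi>\<^sub>M x\<in>free_vars S. distr Q borel (\<lambda>\<omega>. \<omega> x))"
      using free_UNIV by (intro PiM_cong) (auto simp: tree_law_distr_coord[OF assms(1)])
    finally show ?thesis
      using free_vars_nonempty[OF False] free_UNIV
      by (subst indep_vars_iff_distr_eq_PiM')
        (auto simp: marginal_def restrict_def intro: measurable_coord[OF Q])
  qed
qed

end

section \<open>The fixed-point law\<close>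

abbreviation (input) U01 :: "real measure" where
  "U01 \<equiv> uniform_measure lborel {0..1}"

lemma prob_space_U01: "prob_space U01"
  by (rule prob_space_uniform_measure) auto

lemma AE_U01: "AE v in U01. v \<in> {0<..1}"
proof -
  have "AE v in lborel. v \<noteq> (0::real)" by (rule AE_lborel_singleton)
  then show ?thesis by (intro AE_uniform_measureI) (auto elim!: eventually_mono)
qed

lemma measure_U01_Icc:
  assumes "0 \<le> a" "a \<le> b" "b \<le> 1"
  shows "measure U01 {a..b} = b - a"
proof -
  have "{0..1} \<inter> {a..b} = {a..b}" using assms by auto
  then show ?thesis using assms by (subst measure_uniform_measure) auto
qed

lemma nn_integral_U01:
  fixes f :: "real \<Rightarrow> real"
  assumes [measurable]: "f \<in> borel_measurable borel" and "\<And>v. v \<in> {0..1} \<Longrightarrow> 0 \<le> f v"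
    and "(f has_integral c) {0..1}"
  shows "(\<integral>\<^sup>+v. ennreal (f v) \<partial>U01) = ennreal c"
proof -
  let ?g = "\<lambda>v. if v \<in> {0..1} then f v else 0"
  have "(\<integral>\<^sup>+v. ennreal (f v) \<partial>U01) = (\<integral>\<^sup>+v. ennreal (?g v) \<partial>lborel)"
    by (subst nn_integral_uniform_measure)
       (auto simp: divide_ennreal_def intro!: nn_integral_cong split: split_indicator)
  also have "\<dots> = ennreal c"
    using assms by (intro nn_integral_has_integral_lborel)
      (auto simp only: has_integral_restrict_UNIV, auto)
  finally show ?thesis .
qed

definition F_quantile :: "real \<Rightarrow> ereal" where
  "F_quantile v = (if v \<le> ln 2 then ereal (exp v / 2) else \<infinity>)"

definition F_law :: "ereal measure" where
  "F_law = distr U01 borel F_quantile"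

lemma measurable_F_quantile [measurable]: "F_quantile \<in> borel_measurable borel"
  unfolding F_quantile_def by measurable

lemma sets_F_law [simp, measurable_cong]: "sets F_law = sets borel"
  by (simp add: F_law_def)

lemma space_F_law [simp]: "space F_law = UNIV"
  by (simp add: F_law_def)

lemma prob_space_F_law: "prob_space F_law"
  unfolding F_law_def by (intro prob_space.prob_space_distr prob_space_U01) simp

lemma ln_2_le_1: "ln 2 \<le> (1::real)"
  using ln_le_minus_one[of "2::real"] by simp

lemma F_dist_eq_ln_min:
  assumes "t < \<infinity>"
  obtains r where "r \<in> {1/2..1}"
    and "\<And>u. u \<le> 1 \<Longrightarrow> F_dist (min (ereal u) t) = ln (2 * max (1/2) (min u r))"
    and "F_dist t = ln (2 * r)"
proof
  let ?r = "max (1/2) (min 1 (real_of_ereal t))"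
  show "?r \<in> {1/2..1}" by auto
  show "F_dist t = ln (2 * ?r)" using assms by (cases t) (auto simp: F_dist_def max_def min_def)
  show "F_dist (min (ereal u) t) = ln (2 * max (1/2) (min u ?r))" if "u \<le> 1" for u
    using assms that by (cases t) (auto simp: F_dist_def max_def min_def)
qed

lemma F_dist_bounds: "0 \<le> F_dist t" "F_dist t \<le> 1"
proof -
  have "0 \<le> F_dist t \<and> F_dist t \<le> 1"
  proof (cases "t < \<infinity>")
    case True
    then obtain r where "r \<in> {1/2..1}" "F_dist t = ln (2 * r)" by (rule F_dist_eq_ln_min)
    moreover from this have "0 \<le> ln (2 * r)" "ln (2 * r) \<le> ln 2" by simp_all
    ultimately show ?thesis using ln_2_le_1 by linarith
  qed (simp add: F_dist_def)
  then show "0 \<le> F_dist t" "F_dist t \<le> 1" by simp_all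
qed

lemma F_quantile_le_iff:
  assumes v: "v \<in> {0<..1}"
  shows "F_quantile v \<le> t \<longleftrightarrow> v \<le> F_dist t"
proof (cases t)
  case (real r)
  have exp_gt: "1/2 < exp v / 2" using v by simp
  have exp_le_iff: "exp v / 2 \<le> s \<longleftrightarrow> v \<le> ln (2 * s)" if "0 < s" for s
    using ln_ge_iff[of "2 * s" v] that by auto
  consider (below) "r \<le> 1/2" | (inside) "1/2 < r" "r \<le> 1" | (above) "1 < r" by linarith
  then show ?thesis
  proof cases
    case below
    then have "r < exp v / 2" using exp_gt by linarith
    then show ?thesis using below v real by (auto simp: F_quantile_def F_dist_def)
  next
    case inside
    then have "v \<le> ln 2" if "v \<le> ln (2 * r)" using order_trans[OF that] inside by simp
    with inside show ?thesis
      using exp_le_iff[of r] real by (auto simp: F_quantile_def F_dist_def)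
  next
    case above
    then show ?thesis using exp_le_iff[of 1] real by (auto simp: F_quantile_def F_dist_def)
  qed
qed (use v in \<open>auto simp: F_quantile_def F_dist_def\<close>)

lemma le_F_quantile_iff:
  assumes v: "v \<in> {0<..1}" and u: "u \<le> 1"
  shows "ereal u \<le> F_quantile v \<longleftrightarrow> F_dist (ereal u) \<le> v"
proof (cases "u \<le> 1/2")
  case True
  have "1/2 < exp v / 2" using v by simp
  then have "u < exp v / 2" using True by linarith
  then show ?thesis using v True by (auto simp: F_quantile_def F_dist_def)
next
  case False
  then have "u \<le> exp v / 2 \<longleftrightarrow> ln (2 * u) \<le> v"
    using ln_le_cancel_iff[of "2 * u" "exp v"] by auto
  moreover have "ln (2 * u) \<le> v" if "ln 2 \<le> v"
    using that u False by (intro order_trans[OF _ that]) simp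
  ultimately show ?thesis using u False by (auto simp: F_quantile_def F_dist_def)
qed

lemma measure_F_law_via_quantile:
  assumes "A \<in> sets borel" "0 \<le> a" "a \<le> b" "b \<le> 1"
    and "\<And>v. v \<in> {0<..1} \<Longrightarrow> F_quantile v \<in> A \<longleftrightarrow> v \<in> {a..b}"
  shows "measure F_law A = b - a"
proof -
  have vimage: "F_quantile -` A \<in> sets borel"
    using measurable_sets_borel[OF measurable_F_quantile assms(1)] .
  have "measure F_law A = measure U01 (F_quantile -` A)"
    using assms(1) by (simp add: F_law_def measure_distr)
  also have "\<dots> = measure U01 {a..b}"
  proof (rule measure_eq_AE)
    show "AE v in U01. v \<in> F_quantile -` A \<longleftrightarrow> v \<in> {a..b}"
      using AE_U01 by (rule eventually_mono) (use assms(5) in blast)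
  qed (simp_all add: vimage)
  finally show ?thesis using assms by (simp add: measure_U01_Icc)
qed

lemma measure_F_law_atMost: "measure F_law {..t} = F_dist t"
  using measure_F_law_via_quantile[of "{..t}" 0 "F_dist t"] F_quantile_le_iff F_dist_bounds by auto

lemma measure_F_law_Icc:
  assumes "u \<le> 1"
  shows "measure F_law {ereal u..t} = F_dist t - F_dist (min (ereal u) t)"
proof (cases "ereal u \<le> t")
  case True
  interpret prob_space F_law by (rule prob_space_F_law)
  have "F_dist (ereal u) \<le> F_dist t"
    unfolding measure_F_law_atMost[symmetric] using True by (intro finite_measure_mono) auto
  with True show ?thesis
    using measure_F_law_via_quantile[of "{ereal u..t}" "F_dist (ereal u)" "F_dist t"]
      F_quantile_le_iff le_F_quantile_iff[OF _ assms] F_dist_bounds by (auto simp: min_def)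
qed (simp add: min_def)

lemma measurable_Phi [measurable]:
  assumes [measurable]: "f \<in> borel_measurable N" "g \<in> borel_measurable N" "h \<in> borel_measurable N"
  shows "(\<lambda>x. Phi (f x) (g x) (h x)) \<in> borel_measurable N"
  unfolding Phi_def by measurable

lemma less_Phi_min_max_iff:
  assumes "t < \<infinity>"
  shows "t < Phi (min x y) (max x y) u \<longleftrightarrow> x \<notin> {ereal u..t} \<and> y \<notin> {ereal u..t}"
  using assms by (auto simp: Phi_def min_def max_def)

lemma has_integral_square_ln:
  fixes c r :: real
  assumes "1/2 \<le> r"
  shows "((\<lambda>u. (c + ln (2 * u))\<^sup>2) has_integral
    r * ((c + ln (2 * r))\<^sup>2 - 2 * (c + ln (2 * r)) + 2) - (c\<^sup>2 - 2 * c + 2) / 2) {1/2..r}"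
proof -
  let ?G = "\<lambda>u. u * ((c + ln (2 * u))\<^sup>2 - 2 * (c + ln (2 * u)) + 2)"
  have "(?G has_vector_derivative (c + ln (2 * u))\<^sup>2) (at u within {1/2..r})"
    if "u \<in> {1/2..r}" for u
    using that unfolding has_real_derivative_iff_has_vector_derivative[symmetric]
    by (auto intro!: derivative_eq_intros simp: field_simps power2_eq_square)
  then show ?thesis
    using fundamental_theorem_of_calculus[OF assms, of ?G "\<lambda>u. (c + ln (2 * u))\<^sup>2"]
    by (simp add: field_simps)
qed

text \<open>For \<open>r\<close> the truncation of \<open>t\<close> to \<open>[1/2, 1]\<close> the integrand is the probability that neither of
  two independent inputs with law \<open>F\<close> lies in \<open>[u, t]\<close>.\<close>

lemma has_integral_square_ln_truncated:
  fixes r :: real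
  assumes r: "r \<in> {1/2..1}"
  shows "((\<lambda>u. (1 - ln (2 * r) + ln (2 * max (1/2) (min u r)))\<^sup>2)
    has_integral (1 - ln (2 * r))) {0..1}"
    (is "(?f has_integral _) _")
proof -
  let ?c = "1 - ln (2 * r)"
  have left: "(?f has_integral ?c\<^sup>2 / 2) {0..1/2}"
    by (rule has_integral_eq[of _ "\<lambda>_. ?c\<^sup>2"])
      (use r has_integral_const_real[of "?c\<^sup>2" 0 "1/2"] in auto)
  have middle: "(?f has_integral r - (?c\<^sup>2 - 2 * ?c + 2) / 2) {1/2..r}"
    by (rule has_integral_eq[of _ "\<lambda>u. (?c + ln (2 * u))\<^sup>2"])
      (use r has_integral_square_ln[of r ?c] in auto)
  have right: "(?f has_integral 1 - r) {r..1}"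
    by (rule has_integral_eq[of _ "\<lambda>_. 1"])
      (use r has_integral_const_real[of "1::real" r 1] in auto)
  have "(?f has_integral ?c\<^sup>2 / 2 + (r - (?c\<^sup>2 - 2 * ?c + 2) / 2) + (1 - r)) {0..1}"
    using r
    by (intro has_integral_combine[OF _ _ has_integral_combine[OF _ _ left middle] right]) auto
  moreover have "?c\<^sup>2 / 2 + (r - (?c\<^sup>2 - 2 * ?c + 2) / 2) + (1 - r) = ?c" by (simp add: field_simps)
  ultimately show ?thesis by metis
qed

lemma nn_integral_square_miss_F_law:
  assumes "t < \<infinity>"
  shows "(\<integral>\<^sup>+u. (emeasure F_law (- {ereal u..t}))\<^sup>2 \<partial>U01) = emeasure F_law {t<..}"
proof -
  interpret prob_space F_law by (rule prob_space_F_law)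
  obtain r where r: "r \<in> {1/2..1}" "F_dist t = ln (2 * r)"
    and F_min: "\<And>u. u \<le> 1 \<Longrightarrow> F_dist (min (ereal u) t) = ln (2 * max (1/2) (min u r))"
    using F_dist_eq_ln_min[OF assms] by blast
  let ?p = "\<lambda>u. 1 - ln (2 * r) + ln (2 * max (1/2) (min u r))"
  have miss: "emeasure F_law (- {ereal u..t}) = ennreal (?p u)" if "u \<le> 1" for u
  proof -
    have "prob (UNIV - {ereal u..t}) = ?p u"
      using prob_compl[of "{ereal u..t}"] measure_F_law_Icc[OF that, of t] F_min[OF that] r by simp
    then show ?thesis by (simp add: emeasure_eq_measure Compl_eq_Diff_UNIV)
  qed
  have p_nonneg: "0 \<le> ?p u" for u
  proof -
    have "ln (2 * r) \<le> 1" using F_dist_bounds(2)[of t] r(2) by simp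
    moreover have "0 \<le> ln (2 * max (1/2) (min u r))" by simp
    ultimately show ?thesis by linarith
  qed
  have "(\<integral>\<^sup>+u. (emeasure F_law (- {ereal u..t}))\<^sup>2 \<partial>U01) = (\<integral>\<^sup>+u. ennreal ((?p u)\<^sup>2) \<partial>U01)"
    using AE_U01
    by (intro nn_integral_cong_AE, elim eventually_mono) (simp add: miss ennreal_power p_nonneg)
  also have "\<dots> = ennreal (1 - ln (2 * r))"
    by (rule nn_integral_U01[OF _ _ has_integral_square_ln_truncated[OF r(1)]]) simp_all
  also have "\<dots> = emeasure F_law {t<..}"
    using prob_compl[of "{..t}"] measure_F_law_atMost[of t]
    by (simp add: emeasure_eq_measure r(2) flip: Compl_atMost Compl_eq_Diff_UNIV)
  finally show ?thesis .
qed

text \<open>The uniform variables are embedded into \<open>ereal\<close>, so that all variables have one value type.\<close>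

definition noise_law :: "ereal measure" where
  "noise_law = distr U01 borel ereal"

lemma prob_space_noise_law: "prob_space noise_law"
  unfolding noise_law_def by (intro prob_space.prob_space_distr prob_space_U01) simp

lemma sets_noise_law [simp, measurable_cong]: "sets noise_law = sets borel"
  by (simp add: noise_law_def)

lemma nn_integral_noise_law:
  assumes "(\<lambda>z. f (real_of_ereal z)) \<in> borel_measurable borel"
  shows "(\<integral>\<^sup>+z. f (real_of_ereal z) \<partial>noise_law) = (\<integral>\<^sup>+u. f u \<partial>U01)"
  unfolding noise_law_def using assms by (subst nn_integral_distr) simp_all

lemma measurable_emeasure_F_law_miss:
  "(\<lambda>z. emeasure F_law (- {ereal (real_of_ereal z)..t})) \<in> borel_measurable borel"
proof -
  interpret prob_space F_law by (rule prob_space_F_law)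
  have "Measurable.pred (borel \<Otimes>\<^sub>M F_law) (\<lambda>p. snd p \<in> - {ereal (real_of_ereal (fst p))..t})"
    unfolding Compl_iff atLeastAtMost_iff by measurable
  then show ?thesis by (intro measurable_emeasure) (simp_all add: pred_def)
qed

lemma nn_integral_less_Phi_eq_square_miss:
  fixes M :: "'i \<Rightarrow> ereal measure"
  assumes M: "\<And>i. prob_space (M i)" "M b = F_law" "M c = F_law" and "b \<noteq> c" and t: "t < \<infinity>"
  shows "(\<integral>\<^sup>+g. indicator {t<..} (Phi (min (g b) (g c)) (max (g b) (g c)) u) \<partial>PiM {b, c} M)
    = (emeasure F_law (- {ereal u..t}))\<^sup>2"
proof -
  interpret product_sigma_finite M
    using M(1) by (simp add: product_sigma_finite_def prob_space_imp_sigma_finite)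
  let ?miss = "indicator (- {ereal u..t}) :: ereal \<Rightarrow> ennreal"
  have "(\<integral>\<^sup>+g. indicator {t<..} (Phi (min (g b) (g c)) (max (g b) (g c)) u) \<partial>PiM {b, c} M)
      = (\<integral>\<^sup>+g. (\<Prod>i\<in>{b, c}. ?miss (g i)) \<partial>PiM {b, c} M)"
    using \<open>b \<noteq> c\<close>
    by (intro nn_integral_cong) (auto simp: less_Phi_min_max_iff[OF t] split: split_indicator)
  also have "\<dots> = (emeasure F_law (- {ereal u..t}))\<^sup>2"
    using \<open>b \<noteq> c\<close> M by (subst product_nn_integral_prod) (auto simp: power2_eq_square)
  finally show ?thesis .
qed

lemma distr_Phi_F_law:
  fixes M :: "'i \<Rightarrow> ereal measure"
  assumes M: "\<And>i. prob_space (M i)" and M_abc: "M a = noise_law" "M b = F_law" "M c = F_law"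
    and distinct: "a \<noteq> b" "a \<noteq> c" "b \<noteq> c"
  shows "distr (PiM {a, b, c} M) borel
    (\<lambda>g. Phi (min (g b) (g c)) (max (g b) (g c)) (real_of_ereal (g a))) = F_law"
    (is "distr ?P borel ?out = F_law")
proof (rule measure_eqI_greaterThan)
  interpret product_sigma_finite M
    using M by (simp add: product_sigma_finite_def prob_space_imp_sigma_finite)
  interpret P: prob_space ?P by (intro prob_space_PiM M)
  have coord: "(\<lambda>g. g i) \<in> borel_measurable (PiM J M)" if "i \<in> J" "i \<in> {a, b, c}" for i J
    using measurable_component_singleton[OF that(1), of M] that(2) M_abc
    by (auto cong: measurable_cong_sets)
  have out_measurable: "?out \<in> borel_measurable ?P"
    using coord[of a "{a, b, c}"] coord[of b "{a, b, c}"] coord[of c "{a, b, c}"] by measurable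
  then show "prob_space (distr ?P borel ?out)" by (rule P.prob_space_distr)
  fix t :: ereal
  show "emeasure (distr ?P borel ?out) {t<..} = emeasure F_law {t<..}"
  proof (cases "t < \<infinity>")
    case True
    have "emeasure (distr ?P borel ?out) {t<..} = (\<integral>\<^sup>+g. indicator {t<..} (?out g) \<partial>?P)"
      using out_measurable by (simp add: nn_integral_distr flip: nn_integral_indicator)
    also have "\<dots> = (\<integral>\<^sup>+z. (\<integral>\<^sup>+g. indicator {t<..} (?out (g(a := z))) \<partial>PiM {b, c} M) \<partial>noise_law)"
      using distinct measurable_compose[OF out_measurable borel_measurable_indicator[of "{t<..}"]]
      by (subst product_nn_integral_insert_rev) (simp_all add: M_abc)
    also have "\<dots> = (\<integral>\<^sup>+z. (emeasure F_law (- {ereal (real_of_ereal z)..t}))\<^sup>2 \<partial>noise_law)"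
      using distinct
      by (simp add: nn_integral_less_Phi_eq_square_miss[OF M M_abc(2,3) distinct(3) True])
    also have "\<dots> = (\<integral>\<^sup>+u. (emeasure F_law (- {ereal u..t}))\<^sup>2 \<partial>U01)"
      using measurable_emeasure_F_law_miss by (intro nn_integral_noise_law) simp
    also have "\<dots> = emeasure F_law {t<..}" using True by (rule nn_integral_square_miss_F_law)
    finally show ?thesis .
  next
    case False
    then have "{t<..} = {}" by auto
    then show ?thesis by simp
  qed
qed (simp_all add: prob_space_F_law)

section \<open>The law on the Bethe lattice\<close>

locale bethe_lattice =
  fixes adj :: "'v \<Rightarrow> 'v \<Rightarrow> bool"
  assumes three_regular: "three_regular_tree adj"

sublocale bethe_lattice \<subseteq> locally_finite_tree adj
proof
  show "finite (nbrs adj i)" for i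
    using three_regular by (intro card_ge_0_finite) (auto simp: three_regular_tree_def)
qed (use three_regular in \<open>auto simp: three_regular_tree_def symp_def irreflp_def\<close>)

context bethe_lattice
begin

definition Phi_message :: "('v var \<Rightarrow> ereal) \<Rightarrow> 'v \<Rightarrow> 'v \<Rightarrow> ereal" where
  "Phi_message \<omega> i j =
     (let Y = (\<lambda>k. \<omega> (Msg i k)) ` (nbrs adj i - {j})
      in Phi (Min Y) (Max Y) (real_of_ereal (\<omega> (Noise i))))"

lemma other_nbrs:
  assumes "adj i j"
  obtains k l where "k \<noteq> l" "nbrs adj i - {j} = {k, l}"
proof -
  have "card (nbrs adj i) = 3" using three_regular by (auto simp: three_regular_tree_def)
  then have "card (nbrs adj i - {j}) = 2" using assms by (simp add: nbrs_def)
  then show ?thesis using that by (auto simp: card_2_iff)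
qed

lemma Phi_message_eq:
  assumes "nbrs adj i - {j} = {k, l}"
  shows "Phi_message \<omega> i j = Phi (min (\<omega> (Msg i k)) (\<omega> (Msg i l))) (max (\<omega> (Msg i k)) (\<omega> (Msg i l)))
    (real_of_ereal (\<omega> (Noise i)))"
  unfolding Phi_message_def assms by simp

lemma inputs_eq:
  assumes "nbrs adj i - {j} = {k, l}"
  shows "inputs i j = {Noise i, Msg i k, Msg i l}"
proof (rule set_eqI)
  show "x \<in> inputs i j \<longleftrightarrow> x \<in> {Noise i, Msg i k, Msg i l}" for x
    using assms by (cases x) (auto simp: nbrs_def)
qed

lemma Phi_message_cong:
  assumes "adj i j" "\<And>x. x \<in> inputs i j \<Longrightarrow> \<omega> x = \<omega>' x"
  shows "Phi_message \<omega> i j = Phi_message \<omega>' i j"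
proof -
  obtain k l where kl: "nbrs adj i - {j} = {k, l}" using other_nbrs[OF assms(1)] by metis
  with assms(2) show ?thesis by (simp add: Phi_message_eq inputs_eq)
qed

lemma measurable_Phi_message:
  assumes "adj i j"
  shows "(\<lambda>\<omega>. Phi_message \<omega> i j) \<in> borel_measurable (borel_PiM (inputs i j))"
proof -
  obtain k l where kl: "nbrs adj i - {j} = {k, l}" using other_nbrs[OF assms] by metis
  show ?thesis unfolding Phi_message_eq[OF kl] inputs_eq[OF kl] by measurable
qed

lemma distr_Phi_message:
  assumes "adj i j"
  shows "distr (PiM (inputs i j) (var_law noise_law F_law)) borel (\<lambda>\<omega>. Phi_message \<omega> i j) = F_law"
proof -
  obtain k l where kl: "k \<noteq> l" "nbrs adj i - {j} = {k, l}" using other_nbrs[OF assms] by metis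
  have "prob_space (var_law noise_law F_law x)" for x :: "'v var"
    by (cases x) (simp_all add: prob_space_noise_law prob_space_F_law)
  then show ?thesis
    unfolding Phi_message_eq[OF kl(2)] inputs_eq[OF kl(2)] using kl(1)
    by (intro distr_Phi_F_law) simp_all
qed

lemma Phi_message_relabel:
  assumes "automorphism adj \<phi>"
  shows "Phi_message (\<lambda>x. \<omega> (map_var \<phi> x)) i j = Phi_message \<omega> (\<phi> i) (\<phi> j)"
proof -
  have "nbrs adj (\<phi> i) - {\<phi> j} = \<phi> ` (nbrs adj i - {j})"
    using inj_automorphism[OF assms] by (simp add: nbrs_automorphism[OF assms] image_set_diff)
  then show ?thesis by (simp add: Phi_message_def image_image)
qed

end

sublocale bethe_lattice \<subseteq> message_passing adj noise_law F_law Phi_message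
  by (intro message_passing.intro message_passing_axioms.intro locally_finite_tree_axioms)
    (rule prob_space_noise_law sets_noise_law prob_space_F_law sets_F_law Phi_message_cong
      measurable_Phi_message distr_Phi_message Phi_message_relabel; assumption)+

section \<open>Transfer to the configuration space\<close>

text \<open>The truncations in \<open>to_unit\<close> and \<open>to_I\<close> only act on null sets; they make the variables lie in
  \<open>[0,1]\<close> and \<open>I\<close> everywhere.\<close>

definition to_unit :: "ereal \<Rightarrow> real" where
  "to_unit x = max 0 (min 1 (real_of_ereal x))"

definition to_I :: "ereal \<Rightarrow> ereal" where
  "to_I y = (if y \<in> I_set then y else \<infinity>)"

lemma to_unit_bounds: "to_unit x \<in> {0..1}"
  by (simp add: to_unit_def)

lemma to_I_in_I_set: "to_I y \<in> I_set"
  by (simp add: to_I_def I_set_def)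

lemma I_set_measurable [measurable]: "I_set \<in> sets borel"
  by (simp add: I_set_def)

lemma measurable_to_unit [measurable]: "to_unit \<in> borel_measurable borel"
  unfolding to_unit_def by measurable

lemma measurable_to_I [measurable]: "to_I \<in> borel_measurable borel"
  unfolding to_I_def by measurable

lemma AE_noise_law_to_unit: "AE x in noise_law. to_unit x = real_of_ereal x"
  unfolding noise_law_def
  by (subst AE_distr_iff) (auto intro!: eventually_mono[OF AE_U01] simp: to_unit_def)

lemma AE_F_law_to_I: "AE y in F_law. to_I y = y"
proof -
  have "exp v \<le> 2" if "v \<le> ln 2" for v :: real using ln_ge_iff[of 2 v] that by simp
  then have "to_I (F_quantile v) = F_quantile v" if "0 < v" for v
    using that by (auto simp: to_I_def F_quantile_def I_set_def)
  then show ?thesis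
    unfolding F_law_def
    by (subst AE_distr_iff) (auto intro!: eventually_mono[OF AE_U01])
qed

context bethe_lattice
begin

definition to_config :: "('v var \<Rightarrow> ereal) \<Rightarrow> 'v config" where
  "to_config \<omega> = (\<lambda>i. to_unit (\<omega> (Noise i)), \<lambda>(i, j)\<in>arcs adj. to_I (\<omega> (Msg i j)))"

lemma U_var_to_config [simp]: "U_var i (to_config \<omega>) = to_unit (\<omega> (Noise i))"
  by (simp add: to_config_def U_var_def)

lemma Y_var_to_config [simp]: "adj i j \<Longrightarrow> Y_var i j (to_config \<omega>) = to_I (\<omega> (Msg i j))"
  by (simp add: to_config_def Y_var_def arcs_def nbrs_def)

lemma measurable_config_spaceI:
  assumes "\<And>i. (\<lambda>x. fst (f x) i) \<in> measurable N (restrict_space borel {0..1})"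
    and "\<And>i j. adj i j \<Longrightarrow> (\<lambda>x. snd (f x) (i, j)) \<in> measurable N (restrict_space borel I_set)"
    and "\<And>x. snd (f x) \<in> extensional (arcs adj)"
  shows "f \<in> measurable N (config_space adj)"
  unfolding config_space_def
proof (rule measurable_pair)
  have "(\<lambda>x. \<lambda>i\<in>UNIV. fst (f x) i) \<in> measurable N (\<Pi>\<^sub>M i\<in>UNIV. restrict_space borel {0..1})"
    by (rule measurable_restrict) (rule assms(1))
  then show "fst \<circ> f \<in> measurable N (\<Pi>\<^sub>M i\<in>UNIV. restrict_space borel {0..1})"
    by (simp add: comp_def restrict_UNIV)
  have "(\<lambda>x. \<lambda>e\<in>arcs adj. snd (f x) e) \<in> measurable N (\<Pi>\<^sub>M e\<in>arcs adj. restrict_space borel I_set)"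
    by (rule measurable_restrict) (use assms(2) in \<open>auto simp: arcs_def nbrs_def\<close>)
  then show "snd \<circ> f \<in> measurable N (\<Pi>\<^sub>M e\<in>arcs adj. restrict_space borel I_set)"
    by (simp add: comp_def extensional_restrict[OF assms(3)])
qed

lemma measurable_to_config: "to_config \<in> measurable (borel_PiM (vars UNIV)) (config_space adj)"
proof (rule measurable_config_spaceI)
  have "(\<lambda>\<omega>. to_unit (\<omega> (Noise i)))
      \<in> measurable (borel_PiM (vars UNIV)) (restrict_space borel {0..1})" for i
    by (intro measurable_restrict_space2) (use to_unit_bounds in auto)
  then show "(\<lambda>\<omega>. fst (to_config \<omega>) i)
      \<in> measurable (borel_PiM (vars UNIV)) (restrict_space borel {0..1})" for i
    by (simp add: to_config_def)
  show "(\<lambda>\<omega>. snd (to_config \<omega>) (i, j))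
      \<in> measurable (borel_PiM (vars UNIV)) (restrict_space borel I_set)"
    if "adj i j" for i j
  proof -
    have "(\<lambda>\<omega>. to_I (\<omega> (Msg i j)))
        \<in> measurable (borel_PiM (vars UNIV)) (restrict_space borel I_set)"
      using that by (intro measurable_restrict_space2) (use to_I_in_I_set in auto)
    then show ?thesis using that by (simp add: to_config_def arcs_def nbrs_def)
  qed
qed (simp add: to_config_def)

lemma measurable_U_var_restrict:
  "U_var i \<in> measurable (config_space adj) (restrict_space borel {0..1})"
  unfolding config_space_def U_var_def[abs_def] by measurable

lemma measurable_Y_var_restrict:
  "adj i j \<Longrightarrow> Y_var i j \<in> measurable (config_space adj) (restrict_space borel I_set)"
  unfolding config_space_def Y_var_def[abs_def]
  by (rule measurable_compose[OF measurable_snd measurable_component_singleton])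
    (simp add: arcs_def nbrs_def)

lemma measurable_U_var: "U_var i \<in> borel_measurable (config_space adj)"
  using measurable_U_var_restrict by (auto simp: measurable_restrict_space2_iff)

lemma measurable_Y_var: "adj i j \<Longrightarrow> Y_var i j \<in> borel_measurable (config_space adj)"
  using measurable_Y_var_restrict by (auto simp: measurable_restrict_space2_iff)

lemma measurable_relabel:
  assumes "automorphism adj \<phi>"
  shows "relabel adj \<phi> \<in> measurable (config_space adj) (config_space adj)"
proof (rule measurable_config_spaceI)
  show "(\<lambda>\<omega>. fst (relabel adj \<phi> \<omega>) i) \<in> measurable (config_space adj) (restrict_space borel {0..1})"
    for i
    using measurable_U_var_restrict by (simp add: relabel_def)
  show "(\<lambda>\<omega>. snd (relabel adj \<phi> \<omega>) (i, j))
      \<in> measurable (config_space adj) (restrict_space borel I_set)"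
    if "adj i j" for i j
    using that measurable_Y_var_restrict[of "\<phi> i" "\<phi> j"] adj_automorphism_iff[OF assms]
    by (simp add: relabel_def arcs_def nbrs_def)
qed (simp add: relabel_def)

lemma relabel_to_config:
  assumes "automorphism adj \<phi>"
  shows "relabel adj \<phi> (to_config \<omega>) = to_config (relabel_vars \<phi> \<omega>)"
proof -
  have "(\<lambda>(i, j)\<in>arcs adj. Y_var (\<phi> i) (\<phi> j) (to_config \<omega>))
      = (\<lambda>(i, j)\<in>arcs adj. to_I (relabel_vars \<phi> \<omega> (Msg i j)))"
    by (rule restrict_ext)
      (auto simp: arcs_def nbrs_def relabel_vars_def adj_automorphism_iff[OF assms])
  then show ?thesis
    by (simp add: relabel_def to_config_def[of "relabel_vars _ _"]) (simp add: relabel_vars_def)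
qed

definition config_law :: "('v var \<Rightarrow> ereal) measure \<Rightarrow> 'v config measure" where
  "config_law Q = distr Q (config_space adj) to_config"

end

locale bethe_process = bethe_lattice adj + Q: prob_space Q
  for adj :: "'v \<Rightarrow> 'v \<Rightarrow> bool" and Q :: "('v var \<Rightarrow> ereal) measure" +
  assumes tree_law: "tree_law Q"
begin

lemma sets_Q: "sets Q = sets (borel_PiM (vars UNIV))"
  using tree_law by (simp add: tree_law_def)

lemma measurable_to_config_Q: "to_config \<in> measurable Q (config_space adj)"
  using measurable_to_config sets_Q by (simp cong: measurable_cong_sets)

sublocale P: prob_space "config_law Q"
  unfolding config_law_def by (rule Q.prob_space_distr[OF measurable_to_config_Q])

lemma sets_config_law: "sets (config_law Q) = sets (config_space adj)"
  by (simp add: config_law_def)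

lemma measurable_Noise: "(\<lambda>\<omega>. \<omega> (Noise i)) \<in> borel_measurable Q"
  using sets_Q by (rule measurable_coord) simp

lemma measurable_Msg: "adj i j \<Longrightarrow> (\<lambda>\<omega>. \<omega> (Msg i j)) \<in> borel_measurable Q"
  using sets_Q by (rule measurable_coord) simp

lemma distr_Noise: "distr Q borel (\<lambda>\<omega>. \<omega> (Noise i)) = noise_law"
  by (simp add: tree_law_distr_coord[OF tree_law])

lemma distr_Msg: "adj i j \<Longrightarrow> distr Q borel (\<lambda>\<omega>. \<omega> (Msg i j)) = F_law"
  by (simp add: tree_law_distr_coord[OF tree_law])

lemma AE_to_unit: "AE \<omega> in Q. to_unit (\<omega> (Noise i)) = real_of_ereal (\<omega> (Noise i))"
  by (rule AE_distrD[OF measurable_Noise]) (simp only: distr_Noise AE_noise_law_to_unit)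

lemma AE_to_I: "adj i j \<Longrightarrow> AE \<omega> in Q. to_I (\<omega> (Msg i j)) = \<omega> (Msg i j)"
  by (rule AE_distrD[OF measurable_Msg]) (simp_all only: distr_Msg AE_F_law_to_I)

lemma indep_vars_U_var: "P.indep_vars (\<lambda>_. borel) U_var UNIV"
proof -
  have "Q.indep_vars (\<lambda>_. borel) (\<lambda>i \<omega>. to_unit (\<omega> (Noise i))) UNIV"
  proof (rule Q.indep_varsI_finite_subsets)
    show "(\<lambda>\<omega>. to_unit (\<omega> (Noise i))) \<in> borel_measurable Q" for i
      by (rule measurable_compose[OF measurable_Noise measurable_to_unit])
    fix J :: "'v set" assume "finite J"
    then obtain S where S: "S \<in> finite_subtrees" "J \<subseteq> S" using finite_subtree_superset by blast
    then have "Q.indep_vars (\<lambda>_. borel) (\<lambda>x \<omega>. \<omega> x) (free_vars S)"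
      by (intro tree_law_indep_vars[OF tree_law]) (simp_all add: finite_subtrees_def)
    then have "Q.indep_vars (\<lambda>_. borel) (\<lambda>i \<omega>. \<omega> (Noise i)) J"
      by (rule Q.indep_vars_reindex) (use S(2) in \<open>auto simp: inj_on_def\<close>)
    then show "Q.indep_vars (\<lambda>_. borel) (\<lambda>i \<omega>. to_unit (\<omega> (Noise i))) J"
      by (rule Q.indep_vars_compose2) simp
  qed
  then show ?thesis
    unfolding config_law_def
    by (subst Q.indep_vars_distr_iff[OF measurable_to_config_Q measurable_U_var]) simp
qed

lemma distr_U_var: "distr (config_law Q) borel (U_var i) = U01"
proof -
  have "distr (config_law Q) borel (U_var i) = distr Q borel (\<lambda>\<omega>. to_unit (\<omega> (Noise i)))"
    unfolding config_law_def
    by (subst distr_distr[OF measurable_U_var measurable_to_config_Q]) (simp add: comp_def)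
  also have "\<dots> = distr Q borel (\<lambda>\<omega>. real_of_ereal (\<omega> (Noise i)))"
    by (intro distr_cong_AE AE_to_unit refl
      measurable_compose[OF measurable_Noise measurable_to_unit]
      borel_measurable_real_of_ereal measurable_Noise)
  also have "\<dots> = distr (distr Q borel (\<lambda>\<omega>. \<omega> (Noise i))) borel real_of_ereal"
    by (subst distr_distr[OF _ measurable_Noise]) (simp_all add: comp_def)
  also have "\<dots> = distr noise_law borel real_of_ereal" by (simp only: distr_Noise)
  also have "\<dots> = U01"
    unfolding noise_law_def by (subst distr_distr) (simp_all add: comp_def distr_id2)
  finally show ?thesis .
qed

lemma automorphism_invariant_config_law: "automorphism_invariant adj (config_law Q)"
  unfolding automorphism_invariant_def
proof (intro allI impI)
  fix \<phi> assume \<phi>: "automorphism adj \<phi>"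
  have relabel_vars_Q: "relabel_vars \<phi> \<in> measurable Q (borel_PiM (vars UNIV))"
    using measurable_relabel_vars[OF \<phi>] sets_Q by (simp cong: measurable_cong_sets)
  have "distr (config_law Q) (config_space adj) (relabel adj \<phi>)
      = distr Q (config_space adj) (\<lambda>\<omega>. to_config (relabel_vars \<phi> \<omega>))"
    unfolding config_law_def
    by (subst distr_distr[OF measurable_relabel[OF \<phi>] measurable_to_config_Q])
      (simp add: comp_def relabel_to_config[OF \<phi>])
  also have "\<dots>
      = distr (distr Q (borel_PiM (vars UNIV)) (relabel_vars \<phi>)) (config_space adj) to_config"
    by (subst distr_distr[OF measurable_to_config relabel_vars_Q]) (simp add: comp_def)
  also have "\<dots> = config_law Q"
    by (simp add: tree_law_invariant[OF \<phi> tree_law] config_law_def)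
  finally show "distr (config_law Q) (config_space adj) (relabel adj \<phi>) = config_law Q" .
qed

lemma has_distribution_function_Y_var:
  assumes "i \<in> nbrs adj j"
  shows "has_distribution_function (config_law Q) (Y_var i j) F_dist"
  unfolding has_distribution_function_def
proof (intro conjI allI)
  have adj: "adj i j" using assms by (simp add: nbrs_def adj_sym)
  have Y_measurable: "Y_var i j \<in> borel_measurable (config_space adj)"
    using adj by (rule measurable_Y_var)
  then show Y_P: "Y_var i j \<in> borel_measurable (config_law Q)" by (simp add: config_law_def)
  have "distr (config_law Q) borel (Y_var i j) = distr Q borel (\<lambda>\<omega>. to_I (\<omega> (Msg i j)))"
    unfolding config_law_def using adj
    by (subst distr_distr[OF Y_measurable measurable_to_config_Q]) (simp add: comp_def)
  also have "\<dots> = distr Q borel (\<lambda>\<omega>. \<omega> (Msg i j))"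
    by (intro distr_cong_AE AE_to_I refl measurable_compose[OF measurable_Msg measurable_to_I]
      measurable_Msg adj)
  also have "\<dots> = F_law" using adj by (rule distr_Msg)
  finally have law_Y: "distr (config_law Q) borel (Y_var i j) = F_law" .
  show "P.prob {\<omega> \<in> space (config_law Q). Y_var i j \<omega> \<le> t} = F_dist t" for t
  proof -
    have "{\<omega> \<in> space (config_law Q). Y_var i j \<omega> \<le> t}
        = Y_var i j -` {..t} \<inter> space (config_law Q)" by auto
    then have "P.prob {\<omega> \<in> space (config_law Q). Y_var i j \<omega> \<le> t} = measure F_law {..t}"
      unfolding law_Y[symmetric] by (subst measure_distr[OF Y_P]) simp_all
    then show ?thesis by (simp add: measure_F_law_atMost)
  qed
qed

lemma AE_Y_var_eq_Phi:
  assumes j: "j \<in> nbrs adj i" and kl: "{k, l} = nbrs adj i - {j}"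
  shows "AE \<omega> in config_law Q. Y_var j i \<omega> =
    Phi (min (Y_var i k \<omega>) (Y_var i l \<omega>)) (max (Y_var i k \<omega>) (Y_var i l \<omega>)) (U_var i \<omega>)"
proof -
  have ij: "adj i j" using j by (simp add: nbrs_def)
  have adj: "adj i k" "adj i l" "adj j i" using kl ij by (auto simp: nbrs_def adj_sym)
  have Phi_measurable: "(\<lambda>\<omega>. Phi (min (Y_var i k \<omega>) (Y_var i l \<omega>))
        (max (Y_var i k \<omega>) (Y_var i l \<omega>)) (U_var i \<omega>))
      \<in> borel_measurable (config_space adj)"
    by (intro measurable_Phi borel_measurable_min borel_measurable_max measurable_Y_var
      measurable_U_var adj)
  have "{j, i} \<in> finite_subtrees"
    by (intro insert_finite_subtree[OF singleton_finite_subtree _ ij]) simp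
  then have "AE \<omega> in Q. recursive_on {j, i} \<omega>"
    using tree_law
    by (intro AE_recursive_on[OF _ sets_Q vars_subset_UNIV]) (simp_all add: tree_law_def)
  then have "AE \<omega> in Q. \<omega> (Msg j i) = Phi (min (\<omega> (Msg i k)) (\<omega> (Msg i l)))
      (max (\<omega> (Msg i k)) (\<omega> (Msg i l))) (real_of_ereal (\<omega> (Noise i)))"
    by (rule eventually_mono) (simp add: recursive_on_def ij Phi_message_eq[OF kl[symmetric]])
  then have "AE \<omega> in Q. Y_var j i (to_config \<omega>) =
      Phi (min (Y_var i k (to_config \<omega>)) (Y_var i l (to_config \<omega>)))
        (max (Y_var i k (to_config \<omega>)) (Y_var i l (to_config \<omega>))) (U_var i (to_config \<omega>))"
    using AE_to_unit[of i] AE_to_I[OF adj(1)] AE_to_I[OF adj(2)] AE_to_I[OF adj(3)]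
    by eventually_elim (simp add: adj)
  then show ?thesis
    unfolding config_law_def
    by (subst AE_distr_iff[OF measurable_to_config_Q
      borel_measurable_eq[OF measurable_Y_var[OF adj(3)] Phi_measurable]])
qed

lemma out_arcs_adj: "(i, j) \<in> out_arcs adj S \<Longrightarrow> adj i j"
  by (simp add: out_arcs_def nbrs_def)

context
  fixes S :: "'v set"
  assumes S: "finite S" "connected_set adj S"
begin

lemma indep_vars_Y_var_out_arcs: "P.indep_vars (\<lambda>_. borel) (\<lambda>(i, j). Y_var i j) (out_arcs adj S)"
proof -
  have "Q.indep_vars (\<lambda>_. borel) (\<lambda>e \<omega>. \<omega> (case_prod Msg e)) (out_arcs adj S)"
    by (rule Q.indep_vars_reindex[OF tree_law_indep_vars[OF tree_law S]])
      (auto simp: inj_on_def free_vars_def)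
  then have "Q.indep_vars (\<lambda>_. borel) (\<lambda>e \<omega>. to_I (\<omega> (case_prod Msg e))) (out_arcs adj S)"
    by (rule Q.indep_vars_compose2) simp
  then have "Q.indep_vars (\<lambda>_. borel) (\<lambda>e \<omega>. (case e of (i, j) \<Rightarrow> Y_var i j) (to_config \<omega>))
      (out_arcs adj S)"
    by (rule Q.indep_vars_cong[THEN iffD1, rotated -1]) (auto simp: out_arcs_adj)
  moreover have "(case e of (i, j) \<Rightarrow> Y_var i j) \<in> borel_measurable (config_space adj)"
    if "e \<in> out_arcs adj S" for e
    using that by (cases e) (auto intro: measurable_Y_var out_arcs_adj)
  ultimately show ?thesis
    unfolding config_law_def by (subst Q.indep_vars_distr_iff[OF measurable_to_config_Q])
qed

lemma indep_pair_Y_var_U_var: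
  "indep_pair (config_law Q)
    (\<Pi>\<^sub>M e\<in>out_arcs adj S. borel) (\<lambda>\<omega>. \<lambda>(i, j)\<in>out_arcs adj S. Y_var i j \<omega>)
    (\<Pi>\<^sub>M i\<in>S. borel) (\<lambda>\<omega>. \<lambda>i\<in>S. U_var i \<omega>)" (is "indep_pair _ ?A ?Y ?B ?U")
  unfolding config_law_def
proof (rule Q.indep_pair_distr[OF measurable_to_config_Q])
  let ?O = "out_arcs adj S"
  show "?Y \<in> measurable (config_space adj) ?A"
    by (intro measurable_restrict) (auto intro: measurable_Y_var out_arcs_adj)
  show "?U \<in> measurable (config_space adj) ?B"
    by (intro measurable_restrict measurable_U_var)
  define get_Y where "get_Y g = (\<lambda>(i, j)\<in>?O. to_I (g (Msg i j)))" for g :: "'v var \<Rightarrow> ereal"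
  define get_U where "get_U g = (\<lambda>i\<in>S. to_unit (g (Noise i)))" for g :: "'v var \<Rightarrow> ereal"
  have "Q.indep_var (borel_PiM (case_prod Msg ` ?O)) (\<lambda>\<omega>. restrict \<omega> (case_prod Msg ` ?O))
      (borel_PiM (Noise ` S)) (\<lambda>\<omega>. restrict \<omega> (Noise ` S))"
    by (rule Q.indep_var_restrict[OF tree_law_indep_vars[OF tree_law S]]) (auto simp: free_vars_def)
  moreover have "get_Y \<in> measurable (borel_PiM (case_prod Msg ` ?O)) ?A"
    unfolding get_Y_def[abs_def] by (intro measurable_restrict)
      (auto intro!: measurable_compose[OF _ measurable_to_I]
        measurable_component_singleton rev_image_eqI)
  moreover have "get_U \<in> measurable (borel_PiM (Noise ` S)) ?B"
    unfolding get_U_def[abs_def] by (intro measurable_restrict) auto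
  ultimately have "indep_pair Q ?A (\<lambda>\<omega>. get_Y (restrict \<omega> (case_prod Msg ` ?O)))
      ?B (\<lambda>\<omega>. get_U (restrict \<omega> (Noise ` S)))"
    by (rule Q.indep_pair_compose)
  moreover have "get_Y (restrict \<omega> (case_prod Msg ` ?O)) = ?Y (to_config \<omega>)" for \<omega>
    unfolding get_Y_def by (rule restrict_ext) (auto simp: out_arcs_adj image_iff)
  moreover have "get_U (restrict \<omega> (Noise ` S)) = ?U (to_config \<omega>)" for \<omega>
    unfolding get_U_def by (rule restrict_ext) auto
  ultimately show "indep_pair Q ?A (\<lambda>\<omega>. ?Y (to_config \<omega>)) ?B (\<lambda>\<omega>. ?U (to_config \<omega>))"
    by simp
qed

end

end

lemma (in bethe_lattice) bethe_process_exists: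
  obtains Q where "bethe_process adj Q"
proof -
  define enc :: "ereal \<Rightarrow> real \<times> real" where
    "enc y = (real_of_ereal y, if y = \<infinity> then 1 else if y = - \<infinity> then - 1 else 0)" for y
  define dec :: "real \<times> real \<Rightarrow> ereal" where
    "dec p = (if snd p = 0 then ereal (fst p) else if snd p = 1 then \<infinity> else - \<infinity>)" for p
  have "enc \<in> borel_measurable borel"
    unfolding enc_def[abs_def] borel_prod[symmetric] by measurable
  moreover have "dec \<in> borel_measurable borel"
    unfolding dec_def[abs_def] borel_prod[symmetric] by measurable
  moreover have "dec (enc y) = y" for y
    by (cases y) (simp_all add: enc_def dec_def)
  ultimately obtain Q where Q: "tree_law Q" by (rule tree_law_exists)
  then have "prob_space Q" by (simp add: tree_law_def)
  with Q show thesis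
    by (intro that[of Q] bethe_process.intro bethe_process_axioms.intro bethe_lattice_axioms)
qed

theorem lemma4p1:
  fixes adj :: "'v \<Rightarrow> 'v \<Rightarrow> bool"
  assumes tree: "three_regular_tree adj"
  shows "\<exists>P :: 'v config measure.
    prob_space P \<and> sets P = sets (config_space adj) \<and>
    prob_space.indep_vars P (\<lambda>_. borel) U_var UNIV \<and>
    (\<forall>i. distr P borel (U_var i) = uniform_measure lborel {0..1}) \<and>
    automorphism_invariant adj P \<and>
    (\<forall>i. \<forall>j\<in>nbrs adj i.
       has_distribution_function P (Y_var j i) F_dist \<and>
       (\<forall>k l. {k, l} = nbrs adj i - {j} \<longrightarrow>
          (AE \<omega> in P. Y_var j i \<omega> =
             Phi (min (Y_var i k \<omega>) (Y_var i l \<omega>))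
                 (max (Y_var i k \<omega>) (Y_var i l \<omega>)) (U_var i \<omega>)))) \<and>
    (\<forall>S. finite S \<and> connected_set adj S \<longrightarrow>
       prob_space.indep_vars P (\<lambda>_. borel) (\<lambda>(i, j). Y_var i j) (out_arcs adj S) \<and>
       indep_pair P
         (\<Pi>\<^sub>M e\<in>out_arcs adj S. borel) (\<lambda>\<omega>. \<lambda>(i, j)\<in>out_arcs adj S. Y_var i j \<omega>)
         (\<Pi>\<^sub>M i\<in>S. borel) (\<lambda>\<omega>. \<lambda>i\<in>S. U_var i \<omega>))"
proof -
  interpret bethe_lattice adj by unfold_locales (rule tree)
  obtain Q where "bethe_process adj Q" by (rule bethe_process_exists)
  then interpret bethe_process adj Q .
  show ?thesis
    by (intro exI[of _ "config_law Q"] conjI allI ballI impI; (elim conjE)?)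
      (rule P.prob_space_axioms sets_config_law indep_vars_U_var distr_U_var
        automorphism_invariant_config_law has_distribution_function_Y_var AE_Y_var_eq_Phi
        indep_vars_Y_var_out_arcs indep_pair_Y_var_U_var; assumption)+
qed

end
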